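(* Let $C$ be a coisotropic subspace of a symplectic vector space $X$, with reduced space $X^C=C/C^\perp$, and let $r=\dim C^\perp$. The Sabot topology restricted to $\mathcal L_{\le r}(X^C)$ is the quotient topology for the restricted reduction operation $\rho^C_\bullet:\mathcal L(X)\to\mathcal L_{\le r}(X^C)$, $L\mapsto(L^C,\mathcal E^C(L))$, and the usual topology on $\mathcal L(X)$.
   Context: Symplectic vector spaces are finite-dimensional; $C^\perp$ is the symplectic orthogonal of $C$, and $C$ is coisotropic if $C^\perp\subseteq C$; $X^C=C/C^\perp$ carries the induced symplectic form. For a symplectic vector space $V$, $\mathcal L(V)$ is the Lagrangian Grassmannian with its usual topology, and the indexed Lagrangian Grassmannian is $\mathcal L_\bullet(V)=\mathcal L(V)\times\mathbb Z_{\ge0}$, the union of the levels $\mathcal L_k(V)=\mathcal L(V)\times\{k\}$; $\mathcal L_{\le r}(V)=\bigcup_{k\le r}\mathcal L_k(V)$. Let $d(L,L')$ be the codimension of $L\cap L'$ in $L$. The sublevel operator is $S(L,k)=\{(L',j)\in\mathcal L_\bullet(V): d(L,L')\le k-j\}$, and $S(\mathcal U)=\bigcup_{p\in\mathcal U}S(p)$. The Sabot topology on $\mathcal L_\bullet(V)$ is the topology having as a basis the sets $S(\mathcal U)$, where $\mathcal U$ ranges over the open subsets of the levels $\mathcal L_k(V)$ (usual topology). For $L\in\mathcal L(X)$: $L^C=(L\cap C)/(L\cap C^\perp)\in\mathcal L(X^C)$ is the reduction of $L$, and the excess is $\mathcal E^C(L)=\dim(L\cap C^\perp)$, equivalently the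 codimension of $L+C$ in $X$. *)

theory Defs
  imports "HOL-Analysis.Analysis"
begin

text \<open>
  Linear and Lagrangian Grassmannians are needed both for a symplectic space \<open>X\<close> and for the quotient
  \<open>C / C\<^sup>\<bottom>\<close>, whose elements are cosets. A real vector space with a bilinear form is therefore given by an
  explicit carrier and explicit operations; every notion below refers to these.
\<close>

record 'v form_space =
  vcarrier :: "'v set"
  vzero :: 'v
  vadd :: "'v \<Rightarrow> 'v \<Rightarrow> 'v"
  vscale :: "real \<Rightarrow> 'v \<Rightarrow> 'v"
  vform :: "'v \<Rightarrow> 'v \<Rightarrow> real"

text \<open>
  Finite-dimensional real vector spaces enter as linear subspaces \<open>S\<close> of a Euclidean space, so that
  dimension \<open>0\<close> is included. The ambient inner product plays no role, and only the values of
  \<open>\<omega>\<close> on \<open>S\<close> matter.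
\<close>

definition subspace_with_form :: "'a::euclidean_space set \<Rightarrow> ('a \<Rightarrow> 'a \<Rightarrow> real) \<Rightarrow> 'a form_space" where
  "subspace_with_form S \<omega> =
     \<lparr>vcarrier = S, vzero = 0, vadd = (+), vscale = (*\<^sub>R), vform = \<omega>\<rparr>"

definition symplectic_form_on :: "'a::euclidean_space set \<Rightarrow> ('a \<Rightarrow> 'a \<Rightarrow> real) \<Rightarrow> bool" where
  "symplectic_form_on S \<omega> \<longleftrightarrow>
     (\<forall>x\<in>S. \<forall>y\<in>S. \<forall>z\<in>S. \<omega> (x + y) z = \<omega> x z + \<omega> y z \<and> \<omega> z (x + y) = \<omega> z x + \<omega> z y) \<and>
     (\<forall>c. \<forall>x\<in>S. \<forall>y\<in>S. \<omega> (c *\<^sub>R x) y = c * \<omega> x y \<and> \<omega> x (c *\<^sub>R y) = c * \<omega> x y) \<and>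
     (\<forall>x\<in>S. \<omega> x x = 0) \<and>
     (\<forall>x\<in>S. (\<forall>y\<in>S. \<omega> x y = 0) \<longrightarrow> x = 0)"


subsection \<open>Linear algebra in a space with form\<close>

definition vsubspace :: "('v, 'm) form_space_scheme \<Rightarrow> 'v set \<Rightarrow> bool" where
  "vsubspace V W \<longleftrightarrow> W \<subseteq> vcarrier V \<and> vzero V \<in> W \<and>
     (\<forall>x\<in>W. \<forall>y\<in>W. vadd V x y \<in> W) \<and> (\<forall>c. \<forall>x\<in>W. vscale V c x \<in> W)"

definition vspan :: "('v, 'm) form_space_scheme \<Rightarrow> 'v set \<Rightarrow> 'v set" where
  "vspan V B = \<Inter>{W. vsubspace V W \<and> B \<subseteq> W}"

definition vindependent :: "('v, 'm) form_space_scheme \<Rightarrow> 'v set \<Rightarrow> bool" where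
  "vindependent V B \<longleftrightarrow> B \<subseteq> vcarrier V \<and> (\<forall>b\<in>B. b \<notin> vspan V (B - {b}))"

definition vdim :: "('v, 'm) form_space_scheme \<Rightarrow> 'v set \<Rightarrow> nat" where
  "vdim V W = card (SOME B. vindependent V B \<and> vspan V B = W)"

definition linear_functional :: "('v, 'm) form_space_scheme \<Rightarrow> ('v \<Rightarrow> real) \<Rightarrow> bool" where
  "linear_functional V f \<longleftrightarrow>
     (\<forall>x\<in>vcarrier V. \<forall>y\<in>vcarrier V. f (vadd V x y) = f x + f y) \<and>
     (\<forall>c. \<forall>x\<in>vcarrier V. f (vscale V c x) = c * f x)"

definition vorth :: "('v, 'm) form_space_scheme \<Rightarrow> 'v set \<Rightarrow> 'v set" where
  "vorth V W = {x \<in> vcarrier V. \<forall>w\<in>W. vform V x w = 0}"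

definition coisotropic :: "('v, 'm) form_space_scheme \<Rightarrow> 'v set \<Rightarrow> bool" where
  "coisotropic V C \<longleftrightarrow> vsubspace V C \<and> vorth V C \<subseteq> C"

definition lagrangians :: "('v, 'm) form_space_scheme \<Rightarrow> 'v set set" where
  "lagrangians V = {L. vsubspace V L \<and> vorth V L = L}"


subsection \<open>The usual topology on the Lagrangian Grassmannian\<close>

text \<open>
  The canonical topology of a finite-dimensional real vector space, described without choosing a basis:
  the coarsest one for which all linear functionals are continuous.
\<close>

definition vtopology :: "('v, 'm) form_space_scheme \<Rightarrow> 'v topology" where
  "vtopology V = topology_generated_by
     {{x \<in> vcarrier V. f x \<in> U} | f U. linear_functional V f \<and> open U}"

definition frames :: "('v, 'm) form_space_scheme \<Rightarrow> nat \<Rightarrow> (nat \<Rightarrow> 'v) set" where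
  "frames V k = {b \<in> {..<k} \<rightarrow>\<^sub>E vcarrier V. inj_on b {..<k} \<and> vindependent V (b ` {..<k})}"

definition frame_topology :: "('v, 'm) form_space_scheme \<Rightarrow> nat \<Rightarrow> (nat \<Rightarrow> 'v) topology" where
  "frame_topology V k = subtopology (product_topology (\<lambda>_. vtopology V) {..<k}) (frames V k)"

definition grassmannian :: "('v, 'm) form_space_scheme \<Rightarrow> nat \<Rightarrow> 'v set set" where
  "grassmannian V k = (\<lambda>b. vspan V (b ` {..<k})) ` frames V k"

text \<open>The quotient topology with respect to \<open>b \<mapsto> span {b 0, \<dots>, b (k - 1)}\<close>.\<close>

definition grassmannian_topology :: "('v, 'm) form_space_scheme \<Rightarrow> nat \<Rightarrow> 'v set topology" where
  "grassmannian_topology V k = topology (\<lambda>U. U \<subseteq> grassmannian V k \<and>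
     openin (frame_topology V k) {b \<in> topspace (frame_topology V k). vspan V (b ` {..<k}) \<in> U})"

lemma openin_grassmannian_topology:
  "openin (grassmannian_topology V k) U \<longleftrightarrow> U \<subseteq> grassmannian V k \<and>
     openin (frame_topology V k) {b \<in> topspace (frame_topology V k). vspan V (b ` {..<k}) \<in> U}"
proof -
  let ?F = "frame_topology V k" and ?s = "\<lambda>b. vspan V (b ` {..<k})"
  have "istopology (\<lambda>U. U \<subseteq> grassmannian V k \<and> openin ?F {b \<in> topspace ?F. ?s b \<in> U})"
    unfolding istopology_def
  proof (intro conjI allI impI)
    fix A B
    assume "A \<subseteq> grassmannian V k \<and> openin ?F {b \<in> topspace ?F. ?s b \<in> A}"
      and "B \<subseteq> grassmannian V k \<and> openin ?F {b \<in> topspace ?F. ?s b \<in> B}"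
    moreover have "{b \<in> topspace ?F. ?s b \<in> A \<inter> B} =
        {b \<in> topspace ?F. ?s b \<in> A} \<inter> {b \<in> topspace ?F. ?s b \<in> B}" by auto
    ultimately show "A \<inter> B \<subseteq> grassmannian V k"
      and "openin ?F {b \<in> topspace ?F. ?s b \<in> A \<inter> B}" by auto
  next
    fix K
    assume *: "\<forall>A\<in>K. A \<subseteq> grassmannian V k \<and> openin ?F {b \<in> topspace ?F. ?s b \<in> A}"
    then show "\<Union>K \<subseteq> grassmannian V k" by auto
    have "{b \<in> topspace ?F. ?s b \<in> \<Union>K} = \<Union>((\<lambda>A. {b \<in> topspace ?F. ?s b \<in> A}) ` K)" by auto
    with * show "openin ?F {b \<in> topspace ?F. ?s b \<in> \<Union>K}" by auto
  qed
  then show ?thesis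
    by (simp add: grassmannian_topology_def)
qed

text \<open>A Lagrangian subspace of a symplectic space of dimension \<open>2n\<close> has dimension \<open>n\<close>.\<close>

definition lagrangian_topology :: "('v, 'm) form_space_scheme \<Rightarrow> 'v set topology" where
  "lagrangian_topology V =
     subtopology (grassmannian_topology V (vdim V (vcarrier V) div 2)) (lagrangians V)"


subsection \<open>The Sabot topology on the indexed Lagrangian Grassmannian\<close>

definition lag_codim :: "('v, 'm) form_space_scheme \<Rightarrow> 'v set \<Rightarrow> 'v set \<Rightarrow> nat" where
  "lag_codim V L L' = vdim V L - vdim V (L \<inter> L')"

definition indexed_lagrangians :: "('v, 'm) form_space_scheme \<Rightarrow> ('v set \<times> nat) set" where
  "indexed_lagrangians V = lagrangians V \<times> UNIV"

definition indexed_lagrangians_le :: "('v, 'm) form_space_scheme \<Rightarrow> nat \<Rightarrow> ('v set \<times> nat) set" where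
  "indexed_lagrangians_le V r = lagrangians V \<times> {..r}"

definition sublevel :: "('v, 'm) form_space_scheme \<Rightarrow> 'v set \<times> nat \<Rightarrow> ('v set \<times> nat) set" where
  "sublevel V = (\<lambda>(L, k). {(L', j) \<in> indexed_lagrangians V. int (lag_codim V L L') \<le> int k - int j})"

definition sabot_base :: "('v, 'm) form_space_scheme \<Rightarrow> ('v set \<times> nat) set set" where
  "sabot_base V = {\<Union>p\<in>U \<times> {k}. sublevel V p | U k. openin (lagrangian_topology V) U}"

definition sabot_topology :: "('v, 'm) form_space_scheme \<Rightarrow> ('v set \<times> nat) topology" where
  "sabot_topology V = topology (arbitrary union_of (\<lambda>B. B \<in> sabot_base V))"


subsection \<open>Symplectic reduction\<close>

definition vcoset :: "('v, 'm) form_space_scheme \<Rightarrow> 'v set \<Rightarrow> 'v \<Rightarrow> 'v set" where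
  "vcoset V D x = {vadd V x d | d. d \<in> D}"

text \<open>
  The quotient \<open>C / C\<^sup>\<bottom>\<close>. In the scalar multiplication the summand \<open>d\<close> is needed because
  \<open>0 \<cdot> A\<close> has to be the coset \<open>C\<^sup>\<bottom>\<close> rather than \<open>{0}\<close>.
\<close>

definition reduced_space :: "('v, 'm) form_space_scheme \<Rightarrow> 'v set \<Rightarrow> 'v set form_space" where
  "reduced_space V C =
     \<lparr>vcarrier = vcoset V (vorth V C) ` C,
      vzero = vorth V C,
      vadd = (\<lambda>A B. {vadd V a b | a b. a \<in> A \<and> b \<in> B}),
      vscale = (\<lambda>c A. {vadd V (vscale V c a) d | a d. a \<in> A \<and> d \<in> vorth V C}),
      vform = (\<lambda>A B. THE t. \<forall>a\<in>A. \<forall>b\<in>B. vform V a b = t)\<rparr>"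

text \<open>
  \<open>(L \<inter> C) / (L \<inter> C\<^sup>\<bottom>)\<close> is regarded as a subspace of \<open>C / C\<^sup>\<bottom>\<close>, namely as the image of
  \<open>L \<inter> C\<close> under the projection.
\<close>

definition lag_reduction :: "('v, 'm) form_space_scheme \<Rightarrow> 'v set \<Rightarrow> 'v set \<Rightarrow> 'v set set" where
  "lag_reduction V C L = vcoset V (vorth V C) ` (L \<inter> C)"

definition excess :: "('v, 'm) form_space_scheme \<Rightarrow> 'v set \<Rightarrow> 'v set \<Rightarrow> nat" where
  "excess V C L = vdim V (L \<inter> vorth V C)"

definition indexed_reduction :: "('v, 'm) form_space_scheme \<Rightarrow> 'v set \<Rightarrow> 'v set \<Rightarrow> 'v set set \<times> nat" where
  "indexed_reduction V C L = (lag_reduction V C L, excess V C L)"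

end

theory Submission
  imports Defs
begin

text \<open>
  Let \<open>D = C\<^sup>\<bottom>\<close>. A complement \<open>Y\<close> of \<open>D\<close> in \<open>C\<close> is a symplectic subspace of \<open>X\<close> that maps
  isomorphically onto the reduced space \<open>C / D\<close>, so everything can be compared inside one Euclidean
  space. There a set of Lagrangian subspaces is open iff with \<open>L\<close> it contains every Lagrangian \<open>L'\<close>
  all of whose vectors lie close to \<open>L\<close>, relative to their length (\<open>openin_lagrangian_topology\<close>).
  With this description continuity statements become norm estimates for sums and intersections of
  subspaces, and no coordinates on the Grassmannian are needed.

  The distance \<open>d(L, L')\<close> behaves well under perturbation: if \<open>L'\<close> moves a little, then \<open>L\<close> can follow
  without increasing the distance (\<open>lagrangian_distance_stable\<close>). Therefore a set of indexed
  Lagrangians is open in the Sabot topology iff its levels are open and it contains the sublevels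
  of its points (\<open>openin_sabot_topology\<close>). Two things remain to be shown.

  Reduction is continuous. Let \<open>L\<close> have excess \<open>k\<close> and reduction \<open>M\<close>, and let \<open>L'\<close> be near \<open>L\<close>, with
  excess \<open>j\<close> and reduction \<open>M'\<close>. In general \<open>M'\<close> is not near \<open>M\<close>, because \<open>L\<close> is not transversal to
  \<open>D\<close>. Exchanging the part \<open>L \<inter> D\<close> of \<open>D\<close> for a dual space outside \<open>C\<close> gives another isotropic
  subspace, transversal to \<open>L\<close>, along which \<open>L\<close> has the same reduction \<open>M\<close>. Along it \<open>L'\<close> has a
  reduction \<open>M\<^sub>1\<close> near \<open>M\<close>, and counting dimensions gives \<open>d(M\<^sub>1, M') \<le> k - j\<close>. So \<open>(M', j)\<close> lies in
  the sublevel of a point near \<open>(M, k)\<close> (\<open>reduction_upper_semicontinuous\<close>).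

  The topology is not coarser than the quotient topology. Let the preimage of \<open>W\<close> be open. For each
  excess \<open>k\<close> there is a continuous section \<open>M \<mapsto> M + N\<close> of the reduction with values in the Lagrangians
  of excess \<open>k\<close>, so the levels of \<open>W\<close> are open. To see that \<open>W\<close> contains the sublevels of its points
  it is enough to lower the index by one, keeping \<open>M\<close> or replacing it by a Lagrangian that meets it in
  codimension one. An explicit symplectic shear close to the identity moves the section \<open>M + N\<close> to a
  Lagrangian with the desired reduction and excess (\<open>excess_lowering\<close>); being close to \<open>M + N\<close>, it
  still lies in the preimage of \<open>W\<close>.
\<close>


section \<open>Linear algebra of a symplectic subspace\<close>

lemma subspace_plus: "subspace A \<Longrightarrow> subspace B \<Longrightarrow> subspace (A + B)"
  using subspace_sums[of A B] by (simp add: set_plus_def Bex_def conj_ac)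

lemma dim_plus_Int:
  fixes A B :: "'a::euclidean_space set"
  assumes "subspace A" "subspace B"
  shows "dim (A + B) + dim (A \<inter> B) = dim A + dim B"
proof -
  have "A + B = {x + y |x y. x \<in> A \<and> y \<in> B}"
    by (auto simp: set_plus_def)
  then show ?thesis
    using dim_sums_Int[OF assms] by simp
qed

lemma dim_plus_direct:
  fixes A B :: "'a::euclidean_space set"
  assumes "subspace A" "subspace B" "A \<inter> B = {0}"
  shows "dim (A + B) = dim A + dim B"
  using dim_plus_Int[OF assms(1,2)] assms(3) by simp

lemma plus_subspace_subset:
  fixes A B :: "'a::real_vector set"
  assumes "A \<subseteq> P" "B \<subseteq> P" "subspace P"
  shows "A + B \<subseteq> P"
  using assms by (auto simp: set_plus_def intro: subspace_add)

lemma subset_plus: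
  fixes A B :: "'a::real_vector set"
  assumes "subspace A" "subspace B"
  shows "A \<subseteq> A + B" "B \<subseteq> A + B"
proof -
  show "A \<subseteq> A + B"
    using subspace_0[OF assms(2)] by (force simp: set_plus_def intro: exI[of _ 0])
  show "B \<subseteq> A + B"
    using subspace_0[OF assms(1)] by (force simp: set_plus_def)
qed

lemma subspace_complement:
  fixes K W :: "'a::euclidean_space set"
  assumes K: "subspace K" and W: "subspace W" and "K \<subseteq> W"
  obtains E where "subspace E" "E \<subseteq> W" "K \<inter> E = {0}" "K + E = W" "dim K + dim E = dim W"
proof -
  define E where "E = {y \<in> W. \<forall>x\<in>K. orthogonal x y}"
  have E: "subspace E" "E \<subseteq> W"
    using W by (auto simp: E_def subspace_def orthogonal_clauses)
  have 0: "K \<inter> E = {0}"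
    using K W by (auto simp: E_def orthogonal_self subspace_0 orthogonal_clauses)
  have d: "dim K + dim E = dim W"
    using dim_subspace_orthogonal_to_vectors[OF K W \<open>K \<subseteq> W\<close>] by (simp add: E_def)
  have "K + E = W"
  proof (rule subspace_dim_equal)
    show "subspace (K + E)" "subspace W" "K + E \<subseteq> W"
      using K W E \<open>K \<subseteq> W\<close> by (simp_all add: subspace_plus plus_subspace_subset)
    show "dim W \<le> dim (K + E)"
      using dim_plus_direct[OF K E(1) 0] d by simp
  qed
  then show ?thesis
    using that E 0 d by blast
qed

lemma dim_Int_modular:
  fixes E Y P :: "'a::euclidean_space set"
  assumes E: "subspace E" and Y: "subspace Y" and P: "subspace P"
    and "E \<subseteq> P" "P \<subseteq> Y + E" "Y \<inter> E = {0}"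
  shows "dim (P \<inter> Y) + dim E = dim P"
proof -
  have eq: "P \<inter> Y + E = P"
  proof
    show "P \<inter> Y + E \<subseteq> P"
      using assms by (intro plus_subspace_subset) auto
    show "P \<subseteq> P \<inter> Y + E"
    proof
      fix p assume "p \<in> P"
      then obtain y e where "p = y + e" "y \<in> Y" "e \<in> E"
        using \<open>P \<subseteq> Y + E\<close> by (auto simp: set_plus_def)
      moreover have "p - e \<in> P"
        using \<open>p \<in> P\<close> \<open>e \<in> E\<close> \<open>E \<subseteq> P\<close> P by (auto intro: subspace_diff)
      ultimately show "p \<in> P \<inter> Y + E"
        by (auto simp: set_plus_def)
    qed
  qed
  have "P \<inter> Y \<inter> E = {0}"
    using assms by (auto simp: subspace_0)
  then show ?thesis
    using dim_plus_direct[of "P \<inter> Y" E] eq P Y E by (simp add: subspace_inter)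
qed

locale symplectic_subspace =
  fixes S :: "'a::euclidean_space set" and \<omega> :: "'a \<Rightarrow> 'a \<Rightarrow> real"
  assumes subspace_S: "subspace S"
    and symplectic_form: "symplectic_form_on S \<omega>"
begin

definition perp :: "'a set \<Rightarrow> 'a set" where
  "perp W = {x \<in> S. \<forall>w\<in>W. \<omega> x w = 0}"

definition lagrangian :: "'a set \<Rightarrow> bool" where
  "lagrangian L \<longleftrightarrow> subspace L \<and> perp L = L"

definition isotropic :: "'a set \<Rightarrow> bool" where
  "isotropic W \<longleftrightarrow> subspace W \<and> W \<subseteq> perp W"

text \<open>
  The Lagrangian that is obtained by reducing \<open>L\<close> along an isotropic \<open>B\<close> and taking the preimage of the
  result in \<open>B\<^sup>\<bottom>\<close>. Among the Lagrangians containing \<open>B\<close> it is the one that has the largest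
  intersection with \<open>L\<close>.
\<close>

definition absorb :: "'a set \<Rightarrow> 'a set \<Rightarrow> 'a set" where
  "absorb B L = L \<inter> perp B + B"

lemma form_add_left: "x \<in> S \<Longrightarrow> y \<in> S \<Longrightarrow> z \<in> S \<Longrightarrow> \<omega> (x + y) z = \<omega> x z + \<omega> y z"
  and form_add_right: "x \<in> S \<Longrightarrow> y \<in> S \<Longrightarrow> z \<in> S \<Longrightarrow> \<omega> z (x + y) = \<omega> z x + \<omega> z y"
  and form_scale_left: "x \<in> S \<Longrightarrow> y \<in> S \<Longrightarrow> \<omega> (c *\<^sub>R x) y = c * \<omega> x y"
  and form_scale_right: "x \<in> S \<Longrightarrow> y \<in> S \<Longrightarrow> \<omega> x (c *\<^sub>R y) = c * \<omega> x y"
  and form_self: "x \<in> S \<Longrightarrow> \<omega> x x = 0"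
  and form_nondegenerate: "x \<in> S \<Longrightarrow> (\<And>y. y \<in> S \<Longrightarrow> \<omega> x y = 0) \<Longrightarrow> x = 0"
  using symplectic_form by (auto simp: symplectic_form_on_def)

lemma form_zero: "x \<in> S \<Longrightarrow> \<omega> 0 x = 0" "x \<in> S \<Longrightarrow> \<omega> x 0 = 0"
  using form_scale_left[of x x 0] form_scale_right[of x x 0] by auto

lemma form_flip:
  assumes "x \<in> S" "y \<in> S"
  shows "\<omega> x y = - \<omega> y x"
proof -
  have "x + y \<in> S"
    using assms subspace_S by (simp add: subspace_add)
  then have "0 = \<omega> (x + y) (x + y)"
    by (simp add: form_self)
  also have "\<dots> = \<omega> x y + \<omega> y x"
    using assms \<open>x + y \<in> S\<close> by (simp add: form_add_left form_add_right form_self[OF assms(1)] form_self[OF assms(2)])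
  finally show ?thesis
    by simp
qed

lemma perp_subset: "perp W \<subseteq> S"
  by (auto simp: perp_def)

lemma perpD: "x \<in> perp W \<Longrightarrow> w \<in> W \<Longrightarrow> \<omega> x w = 0"
  by (simp add: perp_def)

lemma perpD2: "x \<in> perp W \<Longrightarrow> w \<in> W \<Longrightarrow> w \<in> S \<Longrightarrow> \<omega> w x = 0"
  using form_flip[of x w] by (auto simp: perp_def)

lemma perp_sym:
  assumes "A \<subseteq> S" "B \<subseteq> perp A"
  shows "A \<subseteq> perp B"
proof
  fix a assume a: "a \<in> A"
  then have "\<omega> a b = 0" if "b \<in> B" for b
    using perpD2[of b A a] assms that by blast
  then show "a \<in> perp B"
    using a assms(1) by (auto simp: perp_def)
qed

lemma perp_antimono: "A \<subseteq> B \<Longrightarrow> perp B \<subseteq> perp A"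
  by (auto simp: perp_def)

lemma subspace_perp: "W \<subseteq> S \<Longrightarrow> subspace (perp W)"
  using subspace_S form_zero(1) form_add_left form_scale_left
  unfolding perp_def subspace_def by (simp add: subset_iff)

lemma perp_plus:
  assumes "subspace A" "subspace B" "A \<subseteq> S" "B \<subseteq> S"
  shows "perp (A + B) = perp A \<inter> perp B"
proof
  show "perp (A + B) \<subseteq> perp A \<inter> perp B"
    using subset_plus[OF assms(1,2)] perp_antimono by blast
  show "perp A \<inter> perp B \<subseteq> perp (A + B)"
    using assms by (auto simp: perp_def set_plus_def form_add_right subset_iff)
qed

text \<open>
  Pairing with an orthonormal basis turns \<open>\<omega>\<close> into an automorphism of \<open>S\<close> that takes Euclidean
  orthogonality to symplectic orthogonality, so the Euclidean dimension count carries over.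
\<close>

lemma dim_perp:
  assumes W: "subspace W" "W \<subseteq> S"
  shows "dim (perp W) + dim W = dim S"
proof -
  obtain B where B: "B \<subseteq> S" "pairwise orthogonal B" "\<And>x. x \<in> B \<Longrightarrow> norm x = 1"
    "independent B" "card B = dim S" "span B = S"
    using orthonormal_basis_subspace[OF subspace_S] by blast
  have fB: "finite B"
    using B(4) independent_imp_finite by blast
  define P where "P x = (\<Sum>b\<in>B. (x \<bullet> b) *\<^sub>R b)" for x
  have linP: "linear P"
    by (rule linearI)
       (simp_all add: P_def inner_add_left scaleR_left_distrib sum.distrib scaleR_sum_right)
  have PS: "P x \<in> S" for x
    unfolding P_def using B(1) subspace_S by (auto intro!: subspace_sum subspace_scale)
  have Pb: "P b = b" if "b \<in> B" for b
  proof -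
    have "(b \<bullet> c) *\<^sub>R c = (if c = b then b else 0)" if "c \<in> B" for c
      using B(2,3) \<open>b \<in> B\<close> that
      by (auto simp: pairwise_def orthogonal_def dot_square_norm)
    then have "P b = (\<Sum>c\<in>B. if c = b then b else 0)"
      unfolding P_def by (rule sum.cong[OF refl])
    then show ?thesis
      using fB that by simp
  qed
  have Pid: "P x = x" if "x \<in> S" for x
    using linear_eq_on_span[of P id B x] linP Pb that B(6) by (simp add: linear_id)
  define A where "A y = (\<Sum>b\<in>B. \<omega> b (P y) *\<^sub>R b)" for y
  have bS: "b \<in> S" if "b \<in> B" for b
    using that B(1) by blast
  have linA: "linear A"
    using linP PS bS
    by (intro linearI)
       (simp_all add: A_def linear_add linear_scale form_add_right form_scale_right
         scaleR_left_distrib sum.distrib scaleR_sum_right cong: sum.cong)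
  have form_sum: "\<omega> (\<Sum>b\<in>F. c b *\<^sub>R b) y = (\<Sum>b\<in>F. c b * \<omega> b y)"
    if "F \<subseteq> B" "y \<in> S" for F c y
    using finite_subset[OF that(1) fB] that
  proof (induction F rule: finite_induct)
    case (insert b F)
    have "(\<Sum>b\<in>F. c b *\<^sub>R b) \<in> S"
      using insert bS subspace_S by (auto intro!: subspace_sum subspace_scale)
    moreover have "c b *\<^sub>R b \<in> S" "b \<in> S"
      using insert bS subspace_S by (auto intro!: subspace_scale)
    ultimately show ?case
      using insert by (simp add: form_add_left form_scale_left)
  qed (simp add: form_zero)
  have inner_A: "x \<bullet> A y = \<omega> x y" if "x \<in> S" "y \<in> S" for x y
  proof -
    have "x \<bullet> A y = (\<Sum>b\<in>B. (x \<bullet> b) * \<omega> b y)"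
      using that by (simp add: A_def Pid inner_sum_right mult.commute)
    also have "\<dots> = \<omega> (P x) y"
      unfolding P_def using form_sum[of B y "\<lambda>b. x \<bullet> b"] that by simp
    finally show ?thesis
      using Pid that by simp
  qed
  have AS: "A y \<in> S" for y
    unfolding A_def using B(1) subspace_S by (auto intro!: subspace_sum subspace_scale)
  have inj: "inj_on A S"
  proof (subst linear_inj_on_iff_eq_0[OF linA subspace_S], intro ballI impI)
    fix y assume y: "y \<in> S" "A y = 0"
    have "\<omega> y x = 0" if "x \<in> S" for x
      using inner_A[OF that y(1)] y form_flip[OF y(1) that] by simp
    then show "y = 0"
      using form_nondegenerate y by blast
  qed
  have "perp W = {y \<in> S. \<forall>x\<in>A ` W. orthogonal x y}"
    using W(2) inner_A by (auto simp: perp_def orthogonal_def inner_commute[of "A _"] subset_iff)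
  then have "dim (perp W) + dim (A ` W) = dim S"
    using dim_subspace_orthogonal_to_vectors[of "A ` W" S] AS subspace_S
      linear_subspace_image[OF linA W(1)] by auto
  moreover have "dim (A ` W) = dim W"
    using dim_image_eq[OF linA, of W] inj W by (simp add: inj_on_subset span_eq_iff[THEN iffD2])
  ultimately show ?thesis
    by simp
qed

lemma perp_perp:
  assumes "subspace W" "W \<subseteq> S"
  shows "perp (perp W) = W"
proof (rule sym, rule subspace_dim_equal)
  show "W \<subseteq> perp (perp W)"
    using assms perp_sym by blast
  show "subspace W" "subspace (perp (perp W))"
    using assms subspace_perp perp_subset by auto
  have "dim (perp (perp W)) + dim (perp W) = dim S"
    using dim_perp subspace_perp perp_subset assms by blast
  then show "dim (perp (perp W)) \<le> dim W"
    using dim_perp[OF assms] by simp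
qed

lemma lagrangian_subset: "lagrangian L \<Longrightarrow> L \<subseteq> S"
  using perp_subset[of L] by (simp add: lagrangian_def)

lemma dim_lagrangian: "lagrangian L \<Longrightarrow> 2 * dim L = dim S"
  using dim_perp[of L] lagrangian_subset[of L] by (simp add: lagrangian_def)

lemma lagrangian_isotropic: "lagrangian L \<Longrightarrow> isotropic L"
  by (simp add: lagrangian_def isotropic_def)

lemma isotropic_subset: "isotropic W \<Longrightarrow> W \<subseteq> S"
  unfolding isotropic_def using perp_subset[of W] by blast

lemma isotropic_mono: "isotropic W \<Longrightarrow> subspace V \<Longrightarrow> V \<subseteq> W \<Longrightarrow> isotropic V"
  unfolding isotropic_def using perp_antimono[of V W] by blast

lemma isotropic_line: "v \<in> S \<Longrightarrow> isotropic (span {v})"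
  using subspace_span[of "{v}"] subspace_S
  by (auto simp: isotropic_def perp_def span_singleton form_scale_left form_scale_right
      form_self subspace_scale)

lemma isotropic_plus:
  assumes A: "isotropic A" and B: "isotropic B" and AB: "A \<subseteq> perp B"
  shows "isotropic (A + B)"
  unfolding isotropic_def
proof
  have sub: "subspace A" "subspace B" "A \<subseteq> S" "B \<subseteq> S"
    using A B isotropic_subset[OF A] isotropic_subset[OF B] by (simp_all add: isotropic_def)
  then show "subspace (A + B)"
    by (simp add: subspace_plus)
  have "B \<subseteq> perp A"
    using AB perp_sym[of B A] sub by blast
  then have "A \<subseteq> perp (A + B)" "B \<subseteq> perp (A + B)"
    using perp_plus[of A B] sub A B AB unfolding isotropic_def by blast+
  moreover have "A + B \<subseteq> S"
    using plus_subspace_subset sub subspace_S by blast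
  ultimately show "A + B \<subseteq> perp (A + B)"
    by (rule plus_subspace_subset[OF _ _ subspace_perp])
qed

lemma lagrangianI:
  assumes "isotropic L" "dim S \<le> 2 * dim L"
  shows "lagrangian L"
proof -
  have L: "subspace L" "L \<subseteq> perp L" "L \<subseteq> S"
    using assms(1) isotropic_subset[OF assms(1)] by (simp_all add: isotropic_def)
  have "dim (perp L) \<le> dim L"
    using dim_perp[OF L(1,3)] assms(2) by simp
  then have "L = perp L"
    using subspace_dim_equal[OF L(1) subspace_perp[OF L(3)] L(2)] by blast
  then show ?thesis
    using L by (simp add: lagrangian_def)
qed

lemma lagrangian_eqI:
  assumes "lagrangian L" "lagrangian L'" "L \<subseteq> L'"
  shows "L = L'"
  using subspace_dim_equal[of L L'] assms dim_lagrangian[OF assms(1)] dim_lagrangian[OF assms(2)]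
  by (simp add: lagrangian_def)

lemma dim_Int_perp:
  assumes L: "lagrangian L" and D: "subspace D" "D \<subseteq> S"
  shows "dim (L \<inter> perp D) + dim D = dim L + dim (L \<inter> D)"
proof -
  have sL: "subspace L" "L \<subseteq> S" "perp L = L"
    using L lagrangian_subset[OF L] unfolding lagrangian_def by blast+
  have "L \<inter> perp D = perp (L + D)"
    using perp_plus[of L D] sL D by simp
  moreover have "dim (perp (L + D)) + dim (L + D) = dim S"
    using sL D by (intro dim_perp subspace_plus plus_subspace_subset subspace_S)
  ultimately show ?thesis
    using dim_plus_Int[OF sL(1) D(1)] dim_lagrangian[OF L] by simp
qed

lemma lagrangian_absorb:
  assumes L: "lagrangian L" and D: "isotropic D"
  shows "lagrangian (absorb D L)"
proof (rule lagrangianI)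
  have sub: "subspace L" "L \<subseteq> S" "subspace D" "D \<subseteq> S" "subspace (perp D)" "D \<subseteq> perp D"
    using L D lagrangian_subset[OF L] isotropic_subset[OF D] subspace_perp[of D]
    by (simp_all add: lagrangian_def isotropic_def)
  have "isotropic (L \<inter> perp D)"
    by (rule isotropic_mono[OF lagrangian_isotropic[OF L]]) (simp_all add: sub subspace_inter)
  then show "isotropic (absorb D L)"
    unfolding absorb_def using D by (rule isotropic_plus) simp
  have "L \<inter> perp D \<inter> D = L \<inter> D"
    using sub by blast
  then have "dim (absorb D L) + dim (L \<inter> D) = dim (L \<inter> perp D) + dim D"
    unfolding absorb_def using dim_plus_Int[of "L \<inter> perp D" D] sub by (simp add: subspace_inter)
  then show "dim S \<le> 2 * dim (absorb D L)"
    using dim_Int_perp[OF L sub(3,4)] dim_lagrangian[OF L] by simp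
qed

text \<open>
  A maximal isotropic \<open>E\<close> that meets \<open>L\<close> trivially is a Lagrangian complement: as long as
  \<open>dim E < dim L\<close>, the space \<open>E\<^sup>\<bottom>\<close> is not contained in \<open>E + L\<close>, because the reverse inclusion
  of the orthogonals would put the nonzero space \<open>E\<^sup>\<bottom> \<inter> L\<close> inside \<open>E \<inter> L\<close>. A vector of
  \<open>E\<^sup>\<bottom>\<close> outside \<open>E + L\<close> can be added to \<open>E\<close>.
\<close>

lemma lagrangian_complement_exists:
  assumes L: "lagrangian L"
  obtains L' where "lagrangian L'" "L \<inter> L' = {0}"
proof -
  define Q where "Q E \<longleftrightarrow> isotropic E \<and> L \<inter> E = {0}" for E
  have sL: "subspace L" "L \<subseteq> S" "perp L = L"
    using L lagrangian_subset[OF L] unfolding lagrangian_def by blast+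
  have "0 \<in> S" "0 \<in> L"
    using subspace_S sL by (simp_all add: subspace_0)
  then have "Q {0}"
    using form_zero(1)[of 0] by (auto simp: Q_def isotropic_def perp_def subspace_def)
  moreover have "dim E \<le> dim S" if "Q E" for E
    using dim_subset[OF isotropic_subset, of E] that unfolding Q_def by blast
  ultimately have "\<exists>E. Q E \<and> (\<forall>E'. Q E' \<longrightarrow> dim E' \<le> dim E)"
    by (intro ex_has_greatest_nat[of Q "{0}" dim "Suc (dim S)"]) (auto simp: less_Suc_eq_le)
  then obtain E where E: "Q E" and max: "\<And>E'. Q E' \<Longrightarrow> dim E' \<le> dim E"
    by blast
  have sE: "isotropic E" "subspace E" "E \<subseteq> S" "L \<inter> E = {0}" "E \<subseteq> perp E"
    using E isotropic_subset[of E] by (simp_all add: Q_def isotropic_def)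
  have "dim L \<le> dim E"
  proof (rule ccontr)
    assume less: "\<not> dim L \<le> dim E"
    have "\<not> perp E \<subseteq> E + L"
    proof
      assume "perp E \<subseteq> E + L"
      then have "perp (E + L) \<subseteq> perp (perp E)"
        by (rule perp_antimono)
      then have "L \<inter> perp E \<subseteq> E"
        using perp_plus[of E L] perp_perp[of E] sE sL by auto
      then have "L \<inter> perp E \<subseteq> {0}"
        using sE by blast
      then have "dim (L \<inter> perp E) = 0"
        by (simp add: dim_eq_0)
      moreover have "dim (L \<inter> E) = 0"
        using sE(4) by simp
      ultimately show False
        using dim_Int_perp[OF L sE(2,3)] less by linarith
    qed
    then obtain v where v: "v \<in> perp E" "v \<notin> E + L"
      by blast
    have vS: "v \<in> S"
      using v perp_subset by blast
    have iv: "isotropic (span {v})"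
      using vS by (rule isotropic_line)
    have "E \<subseteq> perp (span {v})"
      using v(1) sE(3) vS perpD2[OF v(1)] by (auto simp: perp_def span_singleton form_scale_right)
    then have iEv: "isotropic (E + span {v})"
      using isotropic_plus[OF sE(1) iv] by blast
    have "L \<inter> (E + span {v}) = {0}"
    proof -
      have "x = 0" if x: "x \<in> L" "x = e + c *\<^sub>R v" "e \<in> E" for x e c
      proof (cases "c = 0")
        case True
        then show ?thesis
          using x sE by auto
      next
        case False
        then have "v = - (inverse c *\<^sub>R e) + inverse c *\<^sub>R x"
          using x(2) by (simp add: algebra_simps)
        moreover have "- (inverse c *\<^sub>R e) \<in> E" "inverse c *\<^sub>R x \<in> L"
          using x sE sL by (auto intro: subspace_neg subspace_scale)
        ultimately show ?thesis
          using v(2) by (metis set_plus_intro)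
      qed
      then have "L \<inter> (E + span {v}) \<subseteq> {0}"
        by (auto simp: set_plus_def span_singleton)
      moreover have "0 \<in> L \<inter> (E + span {v})"
        using sL sE by (simp add: subspace_plus subspace_0)
      ultimately show ?thesis
        by blast
    qed
    then have "dim (E + span {v}) \<le> dim E"
      using max iEv by (simp add: Q_def)
    then have "E = E + span {v}"
      using subspace_dim_equal[OF sE(2) subspace_plus[OF sE(2) subspace_span]]
        subset_plus(1)[OF sE(2) subspace_span] by blast
    then have "v \<in> E"
      using subset_plus(2)[OF sE(2) subspace_span[of "{v}"]] span_base[of v "{v}"] by blast
    then show False
      using v(2) subset_plus(1)[OF sE(2) sL(1)] by blast
  qed
  then have "lagrangian E"
    using lagrangianI[OF sE(1)] dim_lagrangian[OF L] by simp
  then show ?thesis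
    using that sE by blast
qed

end


section \<open>One-sided gaps between subspaces\<close>

text \<open>
  The condition is one-sided: it is the vectors of \<open>M\<close> that have to be near \<open>L\<close>. In this direction it
  passes to intersections with a fixed subspace without any transversality, and for subspaces of
  equal dimension and small \<open>e\<close> it is as strong as the symmetric condition, up to a factor.
\<close>

definition gap_le :: "real \<Rightarrow> 'a::real_normed_vector set \<Rightarrow> 'a set \<Rightarrow> bool" where
  "gap_le e M L \<longleftrightarrow> (\<forall>x\<in>M. \<exists>y\<in>L. norm (x - y) \<le> e * norm x)"

lemma gap_le_refl: "0 \<le> e \<Longrightarrow> gap_le e L L"
  by (force simp: gap_le_def)

lemma gap_le_mono: "gap_le d M L \<Longrightarrow> d \<le> e \<Longrightarrow> gap_le e M L"
  unfolding gap_le_def by (meson mult_right_mono norm_ge_zero order_trans)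

lemma gap_le_zero_iff:
  assumes "gap_le e M {0}" "e < 1"
  shows "M \<subseteq> {0}"
proof
  fix x assume "x \<in> M"
  then have "norm x \<le> e * norm x"
    using assms(1) by (auto simp: gap_le_def)
  then have "(1 - e) * norm x \<le> 0"
    by (simp add: algebra_simps)
  then show "x \<in> {0}"
    using assms(2) by (simp add: mult_le_0_iff)
qed

lemma gap_le_trans:
  assumes "gap_le d A B" "gap_le e B C" "0 \<le> d" "0 \<le> e"
  shows "gap_le (d + e * (1 + d)) A C"
  unfolding gap_le_def
proof
  fix x assume "x \<in> A"
  then obtain y where y: "y \<in> B" "norm (x - y) \<le> d * norm x"
    using assms(1) by (auto simp: gap_le_def)
  then obtain z where z: "z \<in> C" "norm (y - z) \<le> e * norm y"
    using assms(2) by (auto simp: gap_le_def)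
  have "norm y \<le> (1 + d) * norm x"
    using y(2) norm_triangle_ineq2[of y x] by (simp add: norm_minus_commute algebra_simps)
  then have "e * norm y \<le> e * ((1 + d) * norm x)"
    using assms(4) by (rule mult_left_mono)
  then have "norm (x - z) \<le> (d + e * (1 + d)) * norm x"
    using y(2) z(2) norm_triangle_ineq[of "x - y" "y - z"] by (simp add: algebra_simps)
  then show "\<exists>z\<in>C. norm (x - z) \<le> (d + e * (1 + d)) * norm x"
    using z(1) by blast
qed

text \<open>
  Addition is injective on \<open>N \<times> B\<close>, and an injective linear map on a finite-dimensional space is
  bounded below.
\<close>

lemma transversal_norm_bound:
  fixes N B :: "'a::euclidean_space set"
  assumes "subspace N" "subspace B" "N \<inter> B = {0}"
  obtains K where "K > 0" "\<And>n b. n \<in> N \<Longrightarrow> b \<in> B \<Longrightarrow> norm n \<le> K * norm (n + b)"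
proof -
  let ?f = "\<lambda>p::'a \<times> 'a. fst p + snd p"
  have "bounded_linear ?f"
    by (intro bounded_linear_add bounded_linear_fst bounded_linear_snd)
  moreover have "subspace (N \<times> B)"
    using assms by (simp add: subspace_Times)
  moreover have "\<forall>p\<in>N \<times> B. ?f p = 0 \<longrightarrow> p = 0"
  proof (intro ballI impI)
    fix p assume p: "p \<in> N \<times> B" "?f p = 0"
    then have "fst p = - snd p"
      by (simp add: eq_neg_iff_add_eq_0)
    then have "fst p \<in> N \<inter> B"
      using p(1) assms(2) by (auto simp: subspace_neg)
    then have "fst p = 0"
      using assms(3) by simp
    then show "p = 0"
      using p(2) by (simp add: prod_eq_iff)
  qed
  ultimately obtain e where e: "e > 0" "\<And>p. p \<in> N \<times> B \<Longrightarrow> e * norm p \<le> norm (?f p)"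
    using injective_imp_isometric[of "N \<times> B" ?f] closed_subspace by blast
  have "norm n \<le> inverse e * norm (n + b)" if "n \<in> N" "b \<in> B" for n b
  proof -
    have "e * norm n \<le> e * norm (n, b)"
      using e(1) norm_fst_le[of n b] by simp
    also have "\<dots> \<le> norm (n + b)"
      using e(2)[of "(n, b)"] that by simp
    finally show ?thesis
      using e(1) by (simp add: field_simps)
  qed
  then show ?thesis
    using that[of "inverse e"] e(1) by simp
qed

text \<open>
  Intersecting with a fixed subspace is upper semicontinuous: a vector of \<open>A\<close> that is close to \<open>L\<close>
  is close to \<open>L \<inter> A\<close>, because \<open>A\<close> makes a positive angle with a complement of \<open>L \<inter> A\<close> in \<open>L\<close>.
\<close>

lemma gap_le_Int:
  fixes L A :: "'a::euclidean_space set"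
  assumes L: "subspace L" and A: "subspace A" and "e > 0"
  obtains d where "d > 0" "\<And>L'. gap_le d L' L \<Longrightarrow> gap_le e (L' \<inter> A) (L \<inter> A)"
proof -
  have sub: "subspace (L \<inter> A)"
    using L A by (rule subspace_inter)
  obtain W where W: "subspace W" "W \<subseteq> L" "L \<inter> A \<inter> W = {0}" "L \<inter> A + W = L"
    "dim (L \<inter> A) + dim W = dim L"
    by (rule subspace_complement[OF sub L inf_le1])
  have "W \<inter> A = {0}"
    using W by blast
  then obtain K where K: "K > 0" "\<And>w a. w \<in> W \<Longrightarrow> a \<in> A \<Longrightarrow> norm w \<le> K * norm (w + a)"
    using transversal_norm_bound[OF W(1) A] by blast
  have "gap_le ((K + 1) * e) (L' \<inter> A) (L \<inter> A)" if gap: "gap_le e L' L" for e L'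
    unfolding gap_le_def
  proof
    fix x assume x: "x \<in> L' \<inter> A"
    then obtain y where y: "y \<in> L" "norm (x - y) \<le> e * norm x"
      using gap by (auto simp: gap_le_def)
    then obtain z w where zw: "y = z + w" "z \<in> L \<inter> A" "w \<in> W"
      using W(4) by (metis set_plus_elim)
    have "norm w \<le> K * norm (w + (z - x))"
      using K(2)[of w "z - x"] zw x A by (auto intro: subspace_diff)
    also have "w + (z - x) = - (x - y)"
      using zw(1) by simp
    finally have "norm w \<le> K * (e * norm x)"
      using y(2) K(1) by (smt (verit) mult_left_mono norm_minus_cancel)
    then have "norm (x - z) \<le> (K + 1) * e * norm x"
      using y(2) norm_triangle_ineq[of "x - y" w] zw(1) by (simp add: algebra_simps)
    then show "\<exists>z\<in>L \<inter> A. norm (x - z) \<le> (K + 1) * e * norm x"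
      using zw(2) by blast
  qed
  from this[of "e / (K + 1)"] show ?thesis
    using that[of "e / (K + 1)"] K(1) \<open>e > 0\<close> by simp
qed

text \<open>
  Adding a fixed subspace \<open>B\<close> is continuous at subspaces \<open>N\<close> that are transversal to \<open>B\<close>: the
  summands of \<open>n + b\<close> stay bounded by a multiple of \<open>norm (n + b)\<close>, also for nearby \<open>N'\<close>.
\<close>

lemma gap_le_plus:
  fixes N B :: "'a::euclidean_space set"
  assumes N: "subspace N" and B: "subspace B" and trans: "N \<inter> B = {0}" and "e > 0"
  obtains d where "d > 0" "\<And>N'. gap_le d N' N \<Longrightarrow> gap_le e (N' + B) (N + B)"
proof -
  obtain K where K: "K > 0" "\<And>n b. n \<in> N \<Longrightarrow> b \<in> B \<Longrightarrow> norm n \<le> K * norm (n + b)"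
    using transversal_norm_bound[OF N B trans] by blast
  \<comment> \<open>The first bound makes \<open>n'\<close> at most twice as long as the nearby \<open>n\<close>; the second one lets the error
    term in the estimate of \<open>norm n'\<close> be moved to the other side.\<close>
  define d where "d = min (1/2) (1 / (4 * K))"
  have d: "d > 0"
    using K by (simp add: d_def)
  have "gap_le (4 * K * e) (N' + B) (N + B)"
    if gap: "gap_le e N' N" and e: "0 \<le> e" "e \<le> d" for e N'
    unfolding gap_le_def
  proof
    fix x assume "x \<in> N' + B"
    then obtain n' b where x: "x = n' + b" "n' \<in> N'" "b \<in> B"
      by (rule set_plus_elim)
    then obtain n where n: "n \<in> N" "norm (n' - n) \<le> e * norm n'"
      using gap by (auto simp: gap_le_def)
    have near: "norm (x - (n + b)) \<le> e * norm n'"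
      using n(2) unfolding x(1) by simp
    have "e * norm n' \<le> 1/2 * norm n'"
      using e by (intro mult_right_mono) (auto simp: d_def)
    then have "norm n' \<le> 2 * norm n"
      using n(2) norm_triangle_ineq2[of n' n] by simp
    also have "norm n \<le> K * norm (n + b)"
      using K(2) n(1) x(3) .
    also have "norm (n + b) \<le> norm x + e * norm n'"
      using near norm_triangle_ineq2[of "n + b" x] by (simp add: norm_minus_commute)
    finally have "norm n' \<le> 2 * K * norm x + (2 * K * e) * norm n'"
      using K(1) by (simp add: algebra_simps)
    moreover have "2 * K * e \<le> 1/2"
      using e(2) K(1) by (simp add: d_def field_simps)
    then have "(2 * K * e) * norm n' \<le> 1/2 * norm n'"
      by (rule mult_right_mono) simp
    ultimately have "norm n' \<le> 4 * K * norm x"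
      by simp
    then have "e * norm n' \<le> e * (4 * K * norm x)"
      using e(1) by (rule mult_left_mono)
    then have "norm (x - (n + b)) \<le> 4 * K * e * norm x"
      using near by (simp add: algebra_simps)
    then show "\<exists>y\<in>N + B. norm (x - y) \<le> 4 * K * e * norm x"
      using n(1) x(3) by (intro bexI[of _ "n + b"]) auto
  qed
  moreover define d' where "d' = min d (e / (4 * K))"
  have "d' \<le> e / (4 * K)"
    by (simp add: d'_def)
  then have "4 * K * d' \<le> e"
    using K(1) by (simp add: pos_le_divide_eq mult.commute)
  moreover have "0 < d'" "d' \<le> d"
    using K(1) d \<open>e > 0\<close> by (simp_all add: d'_def)
  ultimately have "gap_le e (N' + B) (N + B)" if "gap_le d' N' N" for N'
    using that by (meson gap_le_mono less_imp_le)
  then show ?thesis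
    using that \<open>0 < d'\<close> by blast
qed

lemma orthogonal_projection_exists:
  fixes L :: "'a::euclidean_space set"
  assumes L: "subspace L"
  obtains P where "linear P" "\<And>x. P x \<in> L" "\<And>x y. y \<in> L \<Longrightarrow> norm (x - P x) \<le> norm (x - y)"
    "\<And>x. x \<in> L \<Longrightarrow> P x = x"
proof -
  obtain B where B: "B \<subseteq> L" "pairwise orthogonal B" "\<And>x. x \<in> B \<Longrightarrow> norm x = 1"
    "independent B" "card B = dim L" "span B = L"
    using orthonormal_basis_subspace[OF L] by blast
  have fB: "finite B"
    using B(4) independent_imp_finite by blast
  define P where "P x = (\<Sum>b\<in>B. (x \<bullet> b) *\<^sub>R b)" for x
  have lin: "linear P"
    by (rule linearI)
       (simp_all add: P_def inner_add_left scaleR_left_distrib sum.distrib scaleR_sum_right)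
  have PL: "P x \<in> L" for x
    unfolding P_def using B(1) L by (auto intro!: subspace_sum subspace_scale)
  have "(x - P x) \<bullet> b = 0" if "b \<in> B" for x b
  proof -
    have "(x \<bullet> c) * (c \<bullet> b) = (if c = b then x \<bullet> b else 0)" if "c \<in> B" for c
      using B(2,3) \<open>b \<in> B\<close> that by (auto simp: pairwise_def orthogonal_def dot_square_norm)
    then have "P x \<bullet> b = (\<Sum>c\<in>B. if c = b then x \<bullet> b else 0)"
      unfolding P_def inner_sum_left inner_scaleR_left by (rule sum.cong[OF refl])
    then show ?thesis
      using fB that by (simp add: inner_diff_left)
  qed
  then have orth: "orthogonal (x - P x) y" if "y \<in> L" for x y
    using that B(6) orthogonal_to_span[of y B "x - P x"] by (auto simp: orthogonal_def)
  have best: "norm (x - P x) \<le> norm (x - y)" if "y \<in> L" for x y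
  proof -
    have "orthogonal (x - P x) (P x - y)"
      using orth PL that L by (auto intro: subspace_diff)
    then have "(norm (x - y))\<^sup>2 = (norm (x - P x))\<^sup>2 + (norm (P x - y))\<^sup>2"
      using norm_add_Pythagorean[of "x - P x" "P x - y"] by simp
    then have "(norm (x - P x))\<^sup>2 \<le> (norm (x - y))\<^sup>2"
      by simp
    then show ?thesis
      by (rule power2_le_imp_le) simp
  qed
  then have "P x = x" if "x \<in> L" for x
    using best[OF that, of x] by simp
  with lin PL best show ?thesis
    using that by blast
qed

text \<open>
  Orthogonal projection onto \<open>L\<close> moves the vectors of a nearby \<open>L'\<close> by little, hence is injective on
  \<open>L'\<close>; by equality of dimensions its inverse is a linear isomorphism \<open>L \<rightarrow> L'\<close> close to the identity.
\<close>

lemma gap_le_linear_iso: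
  fixes L L' :: "'a::euclidean_space set"
  assumes L: "subspace L" and L': "subspace L'" and dim: "dim L' = dim L"
    and gap: "gap_le e L' L" and e: "0 \<le> e" "e \<le> 1/2"
  obtains h where "linear h" "h ` L = L'" "inj_on h L"
    "\<And>x. x \<in> L \<Longrightarrow> norm (h x - x) \<le> 2 * e * norm x"
proof -
  obtain P where P: "linear P" "\<And>x. P x \<in> L" "\<And>x y. y \<in> L \<Longrightarrow> norm (x - P x) \<le> norm (x - y)"
    "\<And>x. x \<in> L \<Longrightarrow> P x = x"
    by (rule orthogonal_projection_exists[OF L]) blast
  have near: "norm (x - P x) \<le> e * norm x" if "x \<in> L'" for x
  proof -
    obtain y where "y \<in> L" "norm (x - y) \<le> e * norm x"
      using gap \<open>x \<in> L'\<close> by (auto simp: gap_le_def)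
    then show ?thesis
      using P(3)[of y x] by simp
  qed
  have twice: "norm x \<le> 2 * norm (P x)" if "x \<in> L'" for x
  proof -
    have "e * norm x \<le> 1/2 * norm x"
      using e by (intro mult_right_mono) auto
    then show ?thesis
      using near[OF that] norm_triangle_ineq2[of x "P x"] by simp
  qed
  have inj: "inj_on P L'"
    using twice by (subst linear_inj_on_iff_eq_0[OF P(1) L']) force
  then have "dim (P ` L') = dim L'"
    using dim_image_eq[OF P(1), of L'] L' by (simp add: span_eq_iff[THEN iffD2])
  then have PL': "P ` L' = L"
    using P(2) L dim linear_subspace_image[OF P(1) L'] by (intro subspace_dim_equal) auto
  obtain h where h: "h ` UNIV \<subseteq> L'" "linear h" "\<And>x. x \<in> L' \<Longrightarrow> h (P x) = x"
    using linear_exists_left_inverse_on[OF P(1) L' inj] by blast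
  have "h ` L = L'"
    using h(3) PL'[symmetric] by (auto simp: image_image)
  moreover have "inj_on h L"
    using h(3) unfolding PL'[symmetric] by (auto simp: inj_on_def)
  moreover have "norm (h y - y) \<le> 2 * e * norm y" if "y \<in> L" for y
  proof -
    obtain x where x: "x \<in> L'" "y = P x"
      using \<open>y \<in> L\<close> PL' by blast
    have "e * norm x \<le> e * (2 * norm (P x))"
      using twice[OF x(1)] e(1) by (rule mult_left_mono)
    then show ?thesis
      using near[OF x(1)] h(3)[OF x(1)] x(2) by simp
  qed
  ultimately show ?thesis
    using that h(2) by blast
qed

text \<open>
  The span of a linearly independent family depends continuously on the family: expressing a vector
  in coordinates and reassembling it with a perturbed family moves it by little.
\<close>

lemma gap_le_span_perturbed:
  fixes b :: "nat \<Rightarrow> 'a::euclidean_space"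
  assumes ind: "independent (b ` {..<k})" and inj: "inj_on b {..<k}" and e: "e > 0"
  obtains d where "d > 0"
    "\<And>c. (\<And>i. i < k \<Longrightarrow> norm (c i - b i) < d) \<Longrightarrow> gap_le e (span (c ` {..<k})) (span (b ` {..<k}))"
proof -
  let ?B = "b ` {..<k}"
  have "\<exists>f::'a \<Rightarrow> real. linear f \<and> (\<forall>j<k. f (b j) = (if j = i then 1 else 0))" if "i < k" for i
  proof -
    obtain f :: "'a \<Rightarrow> real" where f: "linear f" "\<forall>x\<in>?B. f x = (if x = b i then 1 else 0)"
      using linear_independent_extend[OF ind, of "\<lambda>x. if x = b i then 1 else 0"] by blast
    moreover have "b j = b i \<longleftrightarrow> j = i" if "j < k" for j
      using inj that \<open>i < k\<close> by (auto simp: inj_on_def)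
    ultimately show ?thesis
      by auto
  qed
  then obtain f :: "nat \<Rightarrow> 'a \<Rightarrow> real" where f: "\<And>i. i < k \<Longrightarrow> linear (f i)"
    "\<And>i j. i < k \<Longrightarrow> j < k \<Longrightarrow> f i (b j) = (if j = i then 1 else 0)"
    by metis
  have "\<exists>K>0. \<forall>x. norm (f i x) \<le> norm x * K" if "i < k" for i
    using bounded_linear.pos_bounded[of "f i"] f(1)[OF that] linear_conv_bounded_linear by blast
  then obtain K where K: "\<And>i. i < k \<Longrightarrow> K i > 0" "\<And>i x. i < k \<Longrightarrow> norm (f i x) \<le> norm x * K i"
    by metis
  define T where "T = (\<Sum>i<k. K i) + 1"
  have "0 \<le> (\<Sum>i<k. K i)"
    using K(1) by (intro sum_nonneg) (simp add: less_imp_le)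
  then have T: "T > 0"
    by (simp add: T_def)
  define d where "d = min (e / 2) (1/2) / T"
  have d: "d > 0" "d * T = min (e / 2) (1/2)"
    using e T by (auto simp: d_def)
  have "gap_le e (span (c ` {..<k})) (span ?B)"
    if c: "\<And>i. i < k \<Longrightarrow> norm (c i - b i) < d" for c
    unfolding gap_le_def
  proof
    fix x' assume x': "x' \<in> span (c ` {..<k})"
    have lin: "linear (\<lambda>x. \<Sum>i<k. f i x *\<^sub>R a i)" for a :: "nat \<Rightarrow> 'a"
      using f(1) by (intro linear_compose_sum) (auto intro!: linearI simp: linear_add linear_scale scaleR_left_distrib)
    have val: "(\<Sum>i<k. f i (b j) *\<^sub>R a i) = a j" if "j < k" for a :: "nat \<Rightarrow> 'a" and j
    proof -
      have "(\<Sum>i<k. f i (b j) *\<^sub>R a i) = (\<Sum>i<k. if i = j then a i else 0)"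
        using f(2) that by (intro sum.cong) auto
      then show ?thesis
        using that by simp
    qed
    define h where "h x = (\<Sum>i<k. f i x *\<^sub>R c i)" for x
    have "h ` ?B = c ` {..<k}"
      using val[of _ c] by (auto simp: h_def image_image)
    then have "span (c ` {..<k}) = h ` span ?B"
      using linear_span_image[of h ?B] lin[of c] by (simp add: h_def[abs_def])
    then obtain x where x: "x \<in> span ?B" "x' = h x"
      using x' by blast
    have "id x = (\<Sum>i<k. f i x *\<^sub>R b i)"
      by (rule linear_eq_on_span[OF linear_id lin[of b] _ x(1)]) (use val[of _ b] in auto)
    then have "x' - x = (\<Sum>i<k. f i x *\<^sub>R c i) - (\<Sum>i<k. f i x *\<^sub>R b i)"
      using x(2) by (simp add: h_def)
    also have "\<dots> = (\<Sum>i<k. f i x *\<^sub>R (c i - b i))"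
      by (simp add: sum_subtractf scaleR_diff_right)
    also have "norm \<dots> \<le> (\<Sum>i<k. norm x * K i * d)"
    proof (rule sum_norm_le)
      fix i assume "i \<in> {..<k}"
      then have i: "i < k"
        by simp
      have "norm (f i x) * norm (c i - b i) \<le> norm x * K i * d"
        using K(2)[OF i] c[OF i] K(1)[OF i] by (intro mult_mono) auto
      then show "norm (f i x *\<^sub>R (c i - b i)) \<le> norm x * K i * d"
        by simp
    qed
    also have "\<dots> = (norm x * d) * (\<Sum>i<k. K i)"
      by (simp add: sum_distrib_left mult_ac)
    also have "\<dots> \<le> (norm x * d) * T"
      using d(1) by (intro mult_left_mono) (auto simp: T_def)
    also have "\<dots> = (d * T) * norm x"
      by simp
    finally have "norm (x' - x) \<le> min (e / 2) (1/2) * norm x"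
      unfolding d(2) .
    moreover have "min (e / 2) (1/2) * norm x \<le> 1/2 * norm x" "min (e / 2) (1/2) * norm x \<le> e/2 * norm x"
      by (intro mult_right_mono; simp)+
    ultimately have "norm x \<le> 2 * norm x'" "norm (x' - x) \<le> e/2 * norm x"
      using norm_triangle_ineq2[of x x'] by (simp_all add: norm_minus_commute)
    moreover from this have "e / 2 * norm x \<le> e / 2 * (2 * norm x')"
      using e by (intro mult_left_mono) auto
    ultimately have "norm (x' - x) \<le> e * norm x'"
      by simp
    then show "\<exists>y\<in>span ?B. norm (x' - y) \<le> e * norm x'"
      using x(1) by blast
  qed
  then show ?thesis
    using that d(1) by blast
qed


section \<open>The Lagrangian topology in a linear chart\<close>

text \<open>
  A linear isomorphism from a symplectic subspace of a Euclidean space. Both spaces of the theorem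
  have such a chart: the identity for \<open>X\<close>, and the projection of a complement of \<open>C\<^sup>\<bottom>\<close> in \<open>C\<close> for
  the quotient.
\<close>

locale symplectic_chart = symplectic_subspace T \<omega>
  for T :: "'a::euclidean_space set" and \<omega> :: "'a \<Rightarrow> 'a \<Rightarrow> real" +
  fixes V :: "('v, 'm) form_space_scheme" and \<phi> :: "'a \<Rightarrow> 'v"
  assumes chart_bij: "bij_betw \<phi> T (vcarrier V)"
    and chart_zero: "\<phi> 0 = vzero V"
    and chart_add: "x \<in> T \<Longrightarrow> y \<in> T \<Longrightarrow> \<phi> (x + y) = vadd V (\<phi> x) (\<phi> y)"
    and chart_scale: "x \<in> T \<Longrightarrow> \<phi> (c *\<^sub>R x) = vscale V c (\<phi> x)"
    and chart_form: "x \<in> T \<Longrightarrow> y \<in> T \<Longrightarrow> vform V (\<phi> x) (\<phi> y) = \<omega> x y"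
begin

lemma chart_carrier: "x \<in> T \<Longrightarrow> \<phi> x \<in> vcarrier V"
  using chart_bij by (auto simp: bij_betw_def)

lemma chart_inj: "x \<in> T \<Longrightarrow> y \<in> T \<Longrightarrow> \<phi> x = \<phi> y \<longleftrightarrow> x = y"
  using chart_bij by (auto simp: bij_betw_def inj_on_def)

lemma chart_image_subset: "W \<subseteq> T \<Longrightarrow> \<phi> ` W \<subseteq> vcarrier V"
  using chart_carrier by blast

lemma chart_mem_image: "x \<in> T \<Longrightarrow> W \<subseteq> T \<Longrightarrow> \<phi> x \<in> \<phi> ` W \<longleftrightarrow> x \<in> W"
  using chart_inj by blast

lemma chart_image_mono: "A \<subseteq> T \<Longrightarrow> B \<subseteq> T \<Longrightarrow> \<phi> ` A \<subseteq> \<phi> ` B \<longleftrightarrow> A \<subseteq> B"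
  using chart_mem_image by blast

lemma chart_image_eq: "A \<subseteq> T \<Longrightarrow> B \<subseteq> T \<Longrightarrow> \<phi> ` A = \<phi> ` B \<longleftrightarrow> A = B"
  using chart_image_mono[of A B] chart_image_mono[of B A] by blast

lemma chart_image_Int: "A \<subseteq> T \<Longrightarrow> B \<subseteq> T \<Longrightarrow> \<phi> ` A \<inter> \<phi> ` B = \<phi> ` (A \<inter> B)"
  using chart_inj by blast

lemma chart_image_exhaust:
  assumes "W \<subseteq> vcarrier V"
  obtains W' where "W' \<subseteq> T" "W = \<phi> ` W'"
proof -
  have "W = \<phi> ` {x \<in> T. \<phi> x \<in> W}"
    using assms chart_bij by (auto simp: bij_betw_def image_iff)
  then show ?thesis
    using that[of "{x \<in> T. \<phi> x \<in> W}"] by blast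
qed

lemma vsubspace_image:
  assumes "W \<subseteq> T"
  shows "vsubspace V (\<phi> ` W) \<longleftrightarrow> subspace W"
proof -
  have "vzero V \<in> \<phi> ` W \<longleftrightarrow> 0 \<in> W"
    using chart_mem_image[of 0 W] assms subspace_S by (simp add: chart_zero subspace_0)
  moreover have "vadd V (\<phi> x) (\<phi> y) \<in> \<phi> ` W \<longleftrightarrow> x + y \<in> W" if "x \<in> W" "y \<in> W" for x y
    using chart_mem_image[of "x + y" W] chart_add[of x y] assms that subspace_S
    by (metis subsetD subspace_add)
  moreover have "vscale V c (\<phi> x) \<in> \<phi> ` W \<longleftrightarrow> c *\<^sub>R x \<in> W" if "x \<in> W" for x c
    using chart_mem_image[of "c *\<^sub>R x" W] chart_scale[of x c] assms that subspace_S
    by (metis subsetD subspace_scale)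
  ultimately show ?thesis
    using chart_image_subset[OF assms] unfolding vsubspace_def subspace_def ball_simps by simp
qed

lemma vspan_image:
  assumes "B \<subseteq> T"
  shows "vspan V (\<phi> ` B) = \<phi> ` span B"
proof
  have sT: "span B \<subseteq> T"
    using assms subspace_S by (rule span_minimal)
  have "vsubspace V (\<phi> ` span B)"
    using vsubspace_image[OF sT] by simp
  then show "vspan V (\<phi> ` B) \<subseteq> \<phi> ` span B"
    unfolding vspan_def using image_mono[OF span_superset[of B], of \<phi>] by (intro Inter_lower) simp
  show "\<phi> ` span B \<subseteq> vspan V (\<phi> ` B)"
    unfolding vspan_def
  proof (rule Inter_greatest, clarify)
    fix W x assume W: "vsubspace V W" "\<phi> ` B \<subseteq> W" and x: "x \<in> span B"
    have "W \<subseteq> vcarrier V"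
      using W(1) by (simp add: vsubspace_def)
    then obtain W' where W': "W' \<subseteq> T" "W = \<phi> ` W'"
      by (rule chart_image_exhaust)
    then have "subspace W'" "B \<subseteq> W'"
      using W assms vsubspace_image chart_image_mono by auto
    then show "\<phi> x \<in> W"
      using x W'(2) span_minimal[of B W'] by blast
  qed
qed

lemma vindependent_image:
  assumes "B \<subseteq> T"
  shows "vindependent V (\<phi> ` B) \<longleftrightarrow> independent B"
proof -
  have "\<phi> b \<in> vspan V (\<phi> ` B - {\<phi> b}) \<longleftrightarrow> b \<in> span (B - {b})" if "b \<in> B" for b
  proof -
    have "\<phi> ` B - {\<phi> b} = \<phi> ` (B - {b})"
      using assms that chart_inj by blast
    moreover have "span (B - {b}) \<subseteq> T"
      using assms subspace_S by (intro span_minimal) auto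
    moreover have "B - {b} \<subseteq> T" "b \<in> T"
      using assms that by auto
    ultimately show ?thesis
      using vspan_image[of "B - {b}"] chart_mem_image[of b "span (B - {b})"] by simp
  qed
  then show ?thesis
    using chart_image_subset[OF assms] by (auto simp: vindependent_def dependent_def)
qed

lemma vdim_image:
  assumes W: "subspace W" "W \<subseteq> T"
  shows "vdim V (\<phi> ` W) = dim W"
proof -
  obtain B where B: "B \<subseteq> W" "independent B" "W \<subseteq> span B"
    by (rule maximal_independent_subset)
  have "span B = W"
    using B W(1) span_minimal by blast
  then have "vindependent V (\<phi> ` B) \<and> vspan V (\<phi> ` B) = \<phi> ` W"
    using B W vindependent_image[of B] vspan_image[of B] by auto
  then have "\<exists>A. vindependent V A \<and> vspan V A = \<phi> ` W"
    by blast
  then have A: "vindependent V A \<and> vspan V A = \<phi> ` W" if "A = (SOME A. vindependent V A \<and> vspan V A = \<phi> ` W)" for A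
    using that by (metis (mono_tags, lifting) someI_ex)
  define A where "A = (SOME A. vindependent V A \<and> vspan V A = \<phi> ` W)"
  have vA: "vindependent V A" "vspan V A = \<phi> ` W"
    using A[OF A_def] by auto
  have "A \<subseteq> vcarrier V"
    using vA(1) by (simp add: vindependent_def)
  then obtain A' where A': "A' \<subseteq> T" "A = \<phi> ` A'"
    by (rule chart_image_exhaust)
  have "independent A'"
    using vA(1) vindependent_image[OF A'(1)] A'(2) by simp
  moreover have "span A' = W"
    using vA(2) vspan_image[OF A'(1)] chart_image_eq[of "span A'" W] A' W span_minimal[OF A'(1) subspace_S]
    by simp
  moreover have "card A = card A'"
    unfolding A'(2) using A'(1) chart_inj by (intro card_image) (auto simp: inj_on_def)
  moreover have "span W = W"
    using W(1) by (simp add: span_eq_iff)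
  ultimately have "card A = dim W"
    using dim_eq_card[of A' W] by metis
  then show ?thesis
    by (simp add: vdim_def A_def)
qed

lemma vorth_image:
  assumes "W \<subseteq> T"
  shows "vorth V (\<phi> ` W) = \<phi> ` perp W"
proof -
  have "vorth V (\<phi> ` W) = {v \<in> \<phi> ` T. \<forall>w\<in>W. vform V v (\<phi> w) = 0}"
    using chart_bij by (simp add: vorth_def bij_betw_def)
  also have "\<dots> = \<phi> ` {x \<in> T. \<forall>w\<in>W. vform V (\<phi> x) (\<phi> w) = 0}"
    by blast
  also have "\<dots> = \<phi> ` perp W"
    using assms chart_form by (intro arg_cong[of _ _ "(`) \<phi>"]) (auto simp: perp_def subset_iff)
  finally show ?thesis .
qed

lemma lagrangians_image:
  assumes "L \<subseteq> T"
  shows "\<phi> ` L \<in> lagrangians V \<longleftrightarrow> lagrangian L"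
  using assms vorth_image[of L] vsubspace_image[of L] chart_image_eq[of "perp L" L] perp_subset[of L]
  by (auto simp: lagrangians_def lagrangian_def)

lemma lagrangians_eq: "lagrangians V = (`) \<phi> ` Collect lagrangian"
proof
  show "(`) \<phi> ` Collect lagrangian \<subseteq> lagrangians V"
    using lagrangians_image lagrangian_subset by blast
  show "lagrangians V \<subseteq> (`) \<phi> ` Collect lagrangian"
  proof
    fix M assume M: "M \<in> lagrangians V"
    then have "M \<subseteq> vcarrier V"
      by (simp add: lagrangians_def vsubspace_def)
    then obtain L where "L \<subseteq> T" "M = \<phi> ` L"
      by (rule chart_image_exhaust)
    then show "M \<in> (`) \<phi> ` Collect lagrangian"
      using M lagrangians_image by blast
  qed
qed

lemma linear_functional_continuous:
  assumes f: "linear_functional V f"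
  shows "continuous_on T (\<lambda>x. f (\<phi> x))"
proof -
  obtain P where P: "linear P" "\<And>x. P x \<in> T"
    "\<And>x y. y \<in> T \<Longrightarrow> norm (x - P x) \<le> norm (x - y)" "\<And>x. x \<in> T \<Longrightarrow> P x = x"
    by (rule orthogonal_projection_exists[OF subspace_S]) blast
  have "linear (\<lambda>x. f (\<phi> (P x)))"
    using f P(1,2) chart_carrier
    by (intro linearI) (simp_all add: linear_functional_def linear_add linear_scale chart_add chart_scale)
  then have "continuous_on T (\<lambda>x. f (\<phi> (P x)))"
    by (intro linear_continuous_on) (simp add: linear_conv_bounded_linear)
  then show ?thesis
    using P(4) by (simp cong: continuous_on_cong)
qed

lemma zero_linear_functional: "linear_functional V (\<lambda>_. 0)"
  by (simp add: linear_functional_def)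

lemma topspace_vtopology: "topspace (vtopology V) = vcarrier V"
proof -
  have "vcarrier V \<in> {{x \<in> vcarrier V. f x \<in> U} |f U. linear_functional V f \<and> open U}"
    using zero_linear_functional by force
  then show ?thesis
    unfolding vtopology_def topology_generated_by_topspace by blast
qed

text \<open>
  In the chart the functionals are continuous for the Euclidean topology, so the topology that they
  generate is not finer than the Euclidean one.
\<close>

lemma vtopology_contains_ball:
  assumes W: "openin (vtopology V) W" and x: "x \<in> T" "\<phi> x \<in> W"
  obtains e where "e > 0" "\<And>y. y \<in> T \<Longrightarrow> norm (y - x) < e \<Longrightarrow> \<phi> y \<in> W"
proof -
  have "continuous_map (top_of_set T) (vtopology V) \<phi>"
    unfolding vtopology_def
  proof (rule continuous_on_generated_topo)
    fix A assume "A \<in> {{x \<in> vcarrier V. f x \<in> U} |f U. linear_functional V f \<and> open U}"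
    then obtain f U where A: "A = {x \<in> vcarrier V. f x \<in> U}" "linear_functional V f" "open U"
      by blast
    have "\<phi> -` A \<inter> topspace (top_of_set T) = T \<inter> (\<lambda>x. f (\<phi> x)) -` U"
      using chart_carrier by (auto simp: A(1))
    then show "openin (top_of_set T) (\<phi> -` A \<inter> topspace (top_of_set T))"
      using continuous_openin_preimage_gen[OF linear_functional_continuous[OF A(2)] A(3)] by simp
  next
    have "vcarrier V \<in> {{x \<in> vcarrier V. f x \<in> U} |f U. linear_functional V f \<and> open U}"
      using zero_linear_functional by force
    then show "\<phi> ` topspace (top_of_set T)
        \<subseteq> \<Union>{{x \<in> vcarrier V. f x \<in> U} |f U. linear_functional V f \<and> open U}"
      using chart_carrier by auto
  qed
  then have "openin (top_of_set T) {x \<in> T. \<phi> x \<in> W}"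
    using W openin_continuous_map_preimage by fastforce
  then show ?thesis
    using that x unfolding openin_euclidean_subtopology_iff dist_norm by blast
qed

text \<open>
  Conversely the Euclidean coordinates are themselves linear functionals.
\<close>

lemma openin_vtopology_image:
  assumes "open U"
  shows "openin (vtopology V) (\<phi> ` (T \<inter> U))"
proof -
  define g where "g = inv_into T \<phi>"
  have g: "g v \<in> T" "\<phi> (g v) = v" if "v \<in> vcarrier V" for v
    using that chart_bij by (auto simp: g_def bij_betw_def inv_into_into f_inv_into_f)
  have g_add: "g (vadd V v w) = g v + g w" if "v \<in> vcarrier V" "w \<in> vcarrier V" for v w
    using chart_add[of "g v" "g w"] g that subspace_S chart_bij inv_into_f_f[of \<phi> T "g v + g w"]
    by (simp add: subspace_add g_def[symmetric] bij_betw_def)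
  have g_scale: "g (vscale V c v) = c *\<^sub>R g v" if "v \<in> vcarrier V" for c v
    using chart_scale[of "g v" c] g that subspace_S chart_bij inv_into_f_f[of \<phi> T "c *\<^sub>R g v"]
    by (simp add: subspace_scale g_def[symmetric] bij_betw_def)
  have coord: "continuous_map (vtopology V) euclidean (\<lambda>v. g v \<bullet> i)" for i
  proof -
    have "linear_functional V (\<lambda>v. g v \<bullet> i)"
      by (simp add: linear_functional_def g_add g_scale inner_add_left)
    then show ?thesis
      unfolding continuous_map_def topspace_vtopology
      unfolding vtopology_def by (auto intro!: topology_generated_by_Basis)
  qed
  have "continuous_map (vtopology V) euclidean (\<lambda>v. \<Sum>i\<in>Basis. (g v \<bullet> i) *\<^sub>R i)"
  proof (intro continuous_map_sum finite_Basis)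
    fix i :: 'a
    have "continuous_map euclidean euclidean (\<lambda>t::real. t *\<^sub>R i)"
      by (simp add: continuous_intros)
    from continuous_map_compose[OF coord[of i] this]
    show "continuous_map (vtopology V) euclidean (\<lambda>v. (g v \<bullet> i) *\<^sub>R i)"
      by (simp add: o_def)
  qed
  then have "continuous_map (vtopology V) euclidean g"
    by (simp add: euclidean_representation)
  then have "openin (vtopology V) {v \<in> topspace (vtopology V). g v \<in> U}"
    using assms openin_continuous_map_preimage by fastforce
  moreover have "{v \<in> topspace (vtopology V). g v \<in> U} = \<phi> ` (T \<inter> U)"
  proof
    show "{v \<in> topspace (vtopology V). g v \<in> U} \<subseteq> \<phi> ` (T \<inter> U)"
      using g by (force simp: topspace_vtopology)
    have "g (\<phi> x) = x" if "x \<in> T" for x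
      using that chart_bij by (simp add: g_def bij_betw_def)
    then show "\<phi> ` (T \<inter> U) \<subseteq> {v \<in> topspace (vtopology V). g v \<in> U}"
      using chart_carrier by (auto simp: topspace_vtopology)
  qed
  ultimately show ?thesis
    by simp
qed

lemma frame_exhaust:
  assumes "b \<in> frames V k"
  obtains c where "c ` {..<k} \<subseteq> T" "\<And>i. i < k \<Longrightarrow> \<phi> (c i) = b i"
    "inj_on c {..<k}" "independent (c ` {..<k})" "vspan V (b ` {..<k}) = \<phi> ` span (c ` {..<k})"
proof -
  define c where "c i = inv_into T \<phi> (b i)" for i
  have b: "\<And>i. i < k \<Longrightarrow> b i \<in> \<phi> ` T" "inj_on b {..<k}" "vindependent V (b ` {..<k})"
    using assms chart_bij by (auto simp: frames_def bij_betw_def)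
  then have c: "c i \<in> T" "\<phi> (c i) = b i" if "i < k" for i
    using that by (auto simp: c_def inv_into_into f_inv_into_f)
  have im: "b ` {..<k} = \<phi> ` c ` {..<k}"
    using c(2) by (simp add: image_image)
  have cT: "c ` {..<k} \<subseteq> T"
    using c by blast
  moreover have "inj_on c {..<k}"
    using b(2) c(2) by (metis (mono_tags, lifting) inj_on_def lessThan_iff)
  moreover have "independent (c ` {..<k})"
    using b(3) vindependent_image[OF cT] im by simp
  ultimately show ?thesis
    using that c(2) vspan_image[OF cT] im by simp
qed

lemma frame_of_basis:
  assumes c: "c ` {..<k} \<subseteq> T" "inj_on c {..<k}" "independent (c ` {..<k})"
  shows "(\<lambda>i\<in>{..<k}. \<phi> (c i)) \<in> frames V k"
    and "vspan V ((\<lambda>i\<in>{..<k}. \<phi> (c i)) ` {..<k}) = \<phi> ` span (c ` {..<k})"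
proof -
  have im: "(\<lambda>i\<in>{..<k}. \<phi> (c i)) ` {..<k} = \<phi> ` c ` {..<k}"
    by (simp add: image_image)
  then show "vspan V ((\<lambda>i\<in>{..<k}. \<phi> (c i)) ` {..<k}) = \<phi> ` span (c ` {..<k})"
    using vspan_image[OF c(1)] by simp
  have "inj_on (\<lambda>i\<in>{..<k}. \<phi> (c i)) {..<k}"
    using c(1,2) chart_inj by (auto simp: inj_on_def image_subset_iff)
  moreover have "vindependent V (\<phi> ` c ` {..<k})"
    using vindependent_image[OF c(1)] c(3) by simp
  ultimately show "(\<lambda>i\<in>{..<k}. \<phi> (c i)) \<in> frames V k"
    using c(1) chart_carrier im by (auto simp: frames_def image_subset_iff)
qed

lemma lagrangian_basis:
  assumes "lagrangian L"
  obtains c where "c ` {..<dim T div 2} \<subseteq> T" "inj_on c {..<dim T div 2}"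
    "independent (c ` {..<dim T div 2})" "span (c ` {..<dim T div 2}) = L"
proof -
  have L: "subspace L" "L \<subseteq> T" "dim L = dim T div 2"
    using assms lagrangian_subset[OF assms] dim_lagrangian[OF assms] by (auto simp: lagrangian_def)
  obtain B where B: "B \<subseteq> L" "independent B" "L \<subseteq> span B" "card B = dim L"
    by (rule basis_exists)
  obtain c where "bij_betw c {0..<card B} B"
    using ex_bij_betw_nat_finite independent_imp_finite[OF B(2)] by blast
  then have c: "inj_on c {..<dim T div 2}" "c ` {..<dim T div 2} = B"
    using B(4) L(3) by (auto simp: bij_betw_def atLeast0LessThan)
  moreover have "span B = L"
    using B L(1) span_minimal by blast
  ultimately show ?thesis
    using that[of c] B L by auto
qed

text \<open>
  Frames close to a given frame span subspaces close to its span, and conversely a subspace close to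
  \<open>L\<close> has a frame close to any given frame of \<open>L\<close>. So the quotient topology of the frames is
  described by one-sided gaps.
\<close>

theorem openin_lagrangian_topology:
  "openin (lagrangian_topology V) U \<longleftrightarrow> U \<subseteq> lagrangians V \<and>
     (\<forall>L. lagrangian L \<and> \<phi> ` L \<in> U \<longrightarrow>
       (\<exists>e>0. \<forall>L'. lagrangian L' \<and> gap_le e L' L \<longrightarrow> \<phi> ` L' \<in> U))"
  (is "_ \<longleftrightarrow> _ \<and> ?near")
proof -
  define k where "k = dim T div 2"
  have "vcarrier V = \<phi> ` T"
    using chart_bij by (simp add: bij_betw_def)
  then have k: "vdim V (vcarrier V) div 2 = k"
    using vdim_image[OF subspace_S] by (simp add: k_def)
  let ?F = "frame_topology V k" and ?s = "\<lambda>b. vspan V (b ` {..<k})"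
  have topF: "topspace ?F = frames V k"
    by (auto simp: frame_topology_def frames_def topspace_vtopology)
  have grass: "\<phi> ` L \<in> grassmannian V k" if "lagrangian L" for L
  proof -
    obtain c where c: "c ` {..<k} \<subseteq> T" "inj_on c {..<k}" "independent (c ` {..<k})" "span (c ` {..<k}) = L"
      by (rule lagrangian_basis[OF \<open>lagrangian L\<close>, folded k_def])
    then show ?thesis
      unfolding grassmannian_def using frame_of_basis[OF c(1-3)] c(4) by (metis imageI)
  qed
  show ?thesis
  proof (intro iffI conjI)
    assume "openin (lagrangian_topology V) U"
    then obtain G where G: "openin (grassmannian_topology V k) G" "U = G \<inter> lagrangians V"
      by (auto simp: lagrangian_topology_def openin_subtopology k)
    then show "U \<subseteq> lagrangians V"
      by blast
    show ?near
    proof (intro allI impI, elim conjE)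
      fix L assume L: "lagrangian L" "\<phi> ` L \<in> U"
      have sL: "subspace L" "L \<subseteq> T"
        using L(1) lagrangian_subset by (auto simp: lagrangian_def)
      obtain c where c: "c ` {..<k} \<subseteq> T" "inj_on c {..<k}" "independent (c ` {..<k})" "span (c ` {..<k}) = L"
        by (rule lagrangian_basis[OF L(1), folded k_def])
      let ?b = "\<lambda>i\<in>{..<k}. \<phi> (c i)"
      let ?Q = "{b \<in> frames V k. ?s b \<in> G}"
      have "?b \<in> ?Q"
        using frame_of_basis[OF c(1-3)] c(4) L(2) G(2) by simp
      moreover have "openin ?F ?Q"
        using G(1) by (simp add: openin_grassmannian_topology topF)
      then obtain A where A: "openin (product_topology (\<lambda>_. vtopology V) {..<k}) A" "?Q = A \<inter> frames V k"
        by (auto simp: frame_topology_def openin_subtopology)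
      ultimately obtain W where W: "\<And>i. i < k \<Longrightarrow> openin (vtopology V) (W i)"
          "?b \<in> PiE {..<k} W" "PiE {..<k} W \<subseteq> A"
        unfolding openin_product_topology_alt by (metis (no_types, lifting) IntD1 lessThan_iff)
      have "\<exists>e>0. \<forall>y\<in>T. norm (y - c i) < e \<longrightarrow> \<phi> y \<in> W i" if "i < k" for i
      proof -
        have "c i \<in> T" "\<phi> (c i) \<in> W i"
          using c(1) W(2) that by (auto simp: PiE_iff)
        then obtain e where "e > 0" "\<And>y. y \<in> T \<Longrightarrow> norm (y - c i) < e \<Longrightarrow> \<phi> y \<in> W i"
          using vtopology_contains_ball[OF W(1)[OF \<open>i < k\<close>]] by blast
        then show ?thesis
          by blast
      qed
      then obtain e where e: "\<And>i. i < k \<Longrightarrow> e i > 0"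
          "\<And>i y. i < k \<Longrightarrow> y \<in> T \<Longrightarrow> norm (y - c i) < e i \<Longrightarrow> \<phi> y \<in> W i"
        by metis
      define N where "N = (\<Sum>i<k. norm (c i)) + 1"
      have N: "norm (c i) < N" if "i < k" for i
        using member_le_sum[of i "{..<k}" "\<lambda>i. norm (c i)"] that by (simp add: N_def)
      have N0: "N > 0"
        by (simp add: N_def sum_nonneg add_nonneg_pos)
      \<comment> \<open>The bound \<open>m \<le> N\<close> gives \<open>d \<le> 1/2\<close>, so that \<open>L\<close> is isomorphic to every \<open>L'\<close> with gap \<open>d\<close>.\<close>
      define m where "m = Min (insert N (e ` {..<k}))"
      have m: "m > 0" "m \<le> N" "\<And>i. i < k \<Longrightarrow> m \<le> e i"
        using e(1) N0 by (auto simp: m_def)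
      define d where "d = m / (2 * N)"
      have d: "0 < d" "d \<le> 1/2" "2 * d * N = m"
        using m N0 by (auto simp: d_def field_simps)
      have "\<phi> ` L' \<in> U" if L': "lagrangian L'" "gap_le d L' L" for L'
      proof -
        have sL': "subspace L'" "L' \<subseteq> T" "dim L' = dim L"
          using L'(1) lagrangian_subset[OF L'(1)] dim_lagrangian[OF L'(1)] dim_lagrangian[OF L(1)]
          by (auto simp: lagrangian_def)
        obtain h where h: "linear h" "h ` L = L'" "inj_on h L"
          "\<And>x. x \<in> L \<Longrightarrow> norm (h x - x) \<le> 2 * d * norm x"
          using gap_le_linear_iso[OF sL(1) sL'(1,3) L'(2) less_imp_le[OF d(1)] d(2)] by blast
        let ?c = "\<lambda>i. h (c i)"
        have cL: "c i \<in> L" if "i < k" for i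
          using c(4) span_superset[of "c ` {..<k}"] that by auto
        have im: "?c ` {..<k} = h ` c ` {..<k}"
          by (simp add: image_image)
        have c': "?c ` {..<k} \<subseteq> T" "inj_on ?c {..<k}"
          using cL h(2) sL'(2) comp_inj_on[OF c(2), of h] inj_on_subset[OF h(3), of "c ` {..<k}"]
          by (auto simp: o_def)
        have "independent (?c ` {..<k})"
          unfolding im using linear_independent_injective_image[OF h(1) c(3)] h(3) c(4) by simp
        note fr = frame_of_basis[OF c' this]
        have "span (?c ` {..<k}) = L'"
          unfolding im using linear_span_image[OF h(1)] c(4) h(2) by metis
        then have sp: "?s (\<lambda>i\<in>{..<k}. \<phi> (?c i)) = \<phi> ` L'"
          using fr(2) by simp
        have "\<phi> (?c i) \<in> W i" if "i < k" for i
        proof -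
          have "norm (?c i - c i) \<le> 2 * d * norm (c i)"
            using h(4) cL that by blast
          also have "\<dots> < 2 * d * N"
            using d(1) N[OF that] by simp
          also have "\<dots> \<le> e i"
            using d(3) m(3) that by simp
          finally show ?thesis
            using e(2)[OF that, of "?c i"] c'(1) that by blast
        qed
        then have "(\<lambda>i\<in>{..<k}. \<phi> (?c i)) \<in> PiE {..<k} W"
          by simp
        then have "(\<lambda>i\<in>{..<k}. \<phi> (?c i)) \<in> ?Q"
          using W(3) A(2) fr(1) by blast
        then have "\<phi> ` L' \<in> G"
          using sp by simp
        then show ?thesis
          using G(2) lagrangians_image[OF sL'(2)] L'(1) by simp
      qed
      then show "\<exists>e>0. \<forall>L'. lagrangian L' \<and> gap_le e L' L \<longrightarrow> \<phi> ` L' \<in> U"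
        using d(1) by blast
    qed
  next
    assume "U \<subseteq> lagrangians V \<and> ?near"
    then have U: "U \<subseteq> lagrangians V"
      and "\<forall>L. \<exists>e. lagrangian L \<and> \<phi> ` L \<in> U \<longrightarrow>
        e > 0 \<and> (\<forall>L'. lagrangian L' \<and> gap_le e L' L \<longrightarrow> \<phi> ` L' \<in> U)"
      by auto
    then obtain e where e: "\<And>L. lagrangian L \<Longrightarrow> \<phi> ` L \<in> U \<Longrightarrow> e L > 0"
      "\<And>L L'. lagrangian L \<Longrightarrow> \<phi> ` L \<in> U \<Longrightarrow> lagrangian L' \<Longrightarrow> gap_le (e L) L' L \<Longrightarrow> \<phi> ` L' \<in> U"
      by metis
    \<comment> \<open>The strict inequality \<open>d < e L\<close> leaves room for a perturbation of \<open>W\<close>.\<close>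
    define G where "G = {\<phi> ` W | W L d. W \<subseteq> T \<and> \<phi> ` W \<in> grassmannian V k \<and>
      lagrangian L \<and> \<phi> ` L \<in> U \<and> 0 \<le> d \<and> d < e L \<and> gap_le d W L}"
    have "U = G \<inter> lagrangians V"
    proof
      show "U \<subseteq> G \<inter> lagrangians V"
      proof
        fix M assume M: "M \<in> U"
        then obtain L where L: "lagrangian L" "M = \<phi> ` L"
          using U lagrangians_eq by blast
        then have "M \<in> G"
          unfolding G_def using M grass[OF L(1)] lagrangian_subset[OF L(1)] e(1)[OF L(1)] gap_le_refl[of 0 L]
          by blast
        then show "M \<in> G \<inter> lagrangians V"
          using M U by blast
      qed
      show "G \<inter> lagrangians V \<subseteq> U"
      proof
        fix M assume M: "M \<in> G \<inter> lagrangians V"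
        then obtain W L d where W: "M = \<phi> ` W" "W \<subseteq> T" "lagrangian L" "\<phi> ` L \<in> U" "d < e L" "gap_le d W L"
          unfolding G_def by blast
        then have "lagrangian W"
          using M lagrangians_image by blast
        then show "M \<in> U"
          using e(2)[OF W(3,4)] gap_le_mono[OF W(6), of "e L"] W(1,5) by simp
      qed
    qed
    moreover have "openin (grassmannian_topology V k) G"
      unfolding openin_grassmannian_topology topF
    proof
      show "G \<subseteq> grassmannian V k"
        unfolding G_def by blast
      show "openin ?F {b \<in> frames V k. ?s b \<in> G}" (is "openin _ ?Q")
      proof (subst openin_subopen, intro ballI)
        fix b assume b: "b \<in> ?Q"
        then have bf: "b \<in> frames V k"
          by simp
        obtain c where c: "c ` {..<k} \<subseteq> T" "\<And>i. i < k \<Longrightarrow> \<phi> (c i) = b i"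
          "inj_on c {..<k}" "independent (c ` {..<k})" "?s b = \<phi> ` span (c ` {..<k})"
          by (rule frame_exhaust[OF bf]) blast
        have cs: "span (c ` {..<k}) \<subseteq> T"
          using c(1) subspace_S by (rule span_minimal)
        obtain W L d where W: "?s b = \<phi> ` W" "W \<subseteq> T" "lagrangian L" "\<phi> ` L \<in> U"
            "0 \<le> d" "d < e L" "gap_le d W L"
          using b unfolding G_def by blast
        have "W = span (c ` {..<k})"
          using W(1,2) c(5) cs chart_image_eq[of W "span (c ` {..<k})"] by simp
        define \<eta> where "\<eta> = (e L - d) / 2 / (1 + d)"
        have "\<eta> * (1 + d) = (e L - d) / 2"
          using nonzero_eq_divide_eq[of "1 + d" \<eta> "(e L - d) / 2"] W(5) \<eta>_def by simp
        moreover have "\<eta> + d * (1 + \<eta>) = d + \<eta> * (1 + d)"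
          by (simp add: algebra_simps)
        ultimately have \<eta>: "\<eta> > 0" "\<eta> + d * (1 + \<eta>) < e L"
          using W(5,6) by (auto simp: \<eta>_def)
        obtain \<delta> where \<delta>: "\<delta> > 0"
          "\<And>c'. (\<And>i. i < k \<Longrightarrow> norm (c' i - c i) < \<delta>) \<Longrightarrow> gap_le \<eta> (span (c' ` {..<k})) (span (c ` {..<k}))"
          using gap_le_span_perturbed[OF c(4,3) \<eta>(1)] by blast
        define A where "A = PiE {..<k} (\<lambda>i. \<phi> ` (T \<inter> ball (c i) \<delta>))"
        have "openin (product_topology (\<lambda>_. vtopology V) {..<k}) A"
          unfolding A_def openin_PiE_gen using openin_vtopology_image by simp
        then have "openin ?F (A \<inter> frames V k)"
          by (auto simp: frame_topology_def openin_subtopology)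
        moreover have "b \<in> A \<inter> frames V k"
        proof -
          have "b i \<in> \<phi> ` (T \<inter> ball (c i) \<delta>)" if "i < k" for i
            using c(1) c(2)[OF that] \<delta>(1) that by (intro image_eqI[of _ _ "c i"]) auto
          then show ?thesis
            using bf by (auto simp: A_def frames_def PiE_iff)
        qed
        moreover have "A \<inter> frames V k \<subseteq> ?Q"
        proof
          fix b' assume b': "b' \<in> A \<inter> frames V k"
          then have bf': "b' \<in> frames V k"
            by simp
          obtain c' where c': "c' ` {..<k} \<subseteq> T" "\<And>i. i < k \<Longrightarrow> \<phi> (c' i) = b' i"
            "inj_on c' {..<k}" "independent (c' ` {..<k})" "?s b' = \<phi> ` span (c' ` {..<k})"
            by (rule frame_exhaust[OF bf']) blast
          have "norm (c' i - c i) < \<delta>" if "i < k" for i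
          proof -
            have "\<phi> (c' i) \<in> \<phi> ` (T \<inter> ball (c i) \<delta>)"
              using b' c'(2)[OF that] that by (auto simp: A_def PiE_iff)
            then have "c' i \<in> T \<inter> ball (c i) \<delta>"
              using chart_mem_image[of "c' i" "T \<inter> ball (c i) \<delta>"] c'(1) that by auto
            then show ?thesis
              by (simp add: dist_norm norm_minus_commute)
          qed
          then have "gap_le \<eta> (span (c' ` {..<k})) W"
            using \<delta>(2) \<open>W = span (c ` {..<k})\<close> by simp
          then have "gap_le (\<eta> + d * (1 + \<eta>)) (span (c' ` {..<k})) L"
            using gap_le_trans W(5,7) \<eta>(1) less_imp_le by blast
          moreover have "0 \<le> \<eta> + d * (1 + \<eta>)"
            using \<eta>(1) W(5) by simp
          moreover have "?s b' \<in> grassmannian V k"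
            unfolding grassmannian_def using bf' by blast
          moreover have "span (c' ` {..<k}) \<subseteq> T"
            using c'(1) subspace_S by (rule span_minimal)
          ultimately have "?s b' \<in> G"
            unfolding G_def mem_Collect_eq using W(3,4) \<eta>(2) c'(5)
            by (intro exI[of _ "span (c' ` {..<k})"] exI[of _ L] exI[of _ "\<eta> + d * (1 + \<eta>)"]) simp
          then show "b' \<in> ?Q"
            using bf' by simp
        qed
        ultimately show "\<exists>B. openin ?F B \<and> b \<in> B \<and> B \<subseteq> ?Q"
          by blast
      qed
    qed
    ultimately show "openin (lagrangian_topology V) U"
      unfolding lagrangian_topology_def k openin_subtopology by blast
  qed
qed

end


section \<open>Perturbing Lagrangian subspaces\<close>

context symplectic_subspace
begin

lemma absorb_continuous:
  assumes L: "lagrangian L" and B: "subspace B" "B \<subseteq> S" and trans: "L \<inter> B = {0}" and e: "e > 0"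
  obtains d where "d > 0" "\<And>L'. gap_le d L' L \<Longrightarrow> gap_le e (absorb B L') (absorb B L)"
proof -
  have sub: "subspace L" "subspace (perp B)" "subspace (L \<inter> perp B)"
    using L B subspace_perp by (simp_all add: lagrangian_def subspace_inter)
  have "L \<inter> perp B \<inter> B = {0}"
    using trans sub(3) B(1) subspace_0 by blast
  then obtain d1 where d1: "d1 > 0"
    "\<And>N'. gap_le d1 N' (L \<inter> perp B) \<Longrightarrow> gap_le e (N' + B) (L \<inter> perp B + B)"
    using gap_le_plus[OF sub(3) B(1) _ e] by blast
  obtain d2 where d2: "d2 > 0" "\<And>L'. gap_le d2 L' L \<Longrightarrow> gap_le d1 (L' \<inter> perp B) (L \<inter> perp B)"
    using gap_le_Int[OF sub(1,2) d1(1)] by blast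
  show ?thesis
    using that[OF d2(1)] d1(2) d2(2) by (simp add: absorb_def)
qed

text \<open>
  \<open>L\<close> arises from \<open>L'\<close> by absorbing a complement \<open>B\<close> of \<open>L \<inter> L'\<close> in \<open>L\<close>. As \<open>B\<close> is transversal to
  \<open>L'\<close>, absorbing the same \<open>B\<close> moves every \<open>L''\<close> near \<open>L'\<close> to a Lagrangian near \<open>L\<close>, and
  it changes \<open>L''\<close> in at most \<open>dim B\<close> directions.
\<close>

lemma lagrangian_distance_stable:
  assumes L: "lagrangian L" and L': "lagrangian L'" and e: "e > 0"
  obtains d where "d > 0"
    "\<And>L''. lagrangian L'' \<Longrightarrow> gap_le d L'' L' \<Longrightarrow>
      \<exists>L1. lagrangian L1 \<and> gap_le e L1 L \<and> dim L1 + dim (L \<inter> L') \<le> dim (L1 \<inter> L'') + dim L"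
proof -
  have sub: "subspace L" "subspace L'" "L \<subseteq> S" "L' \<subseteq> S" "perp L = L"
    using L L' lagrangian_subset[OF L] lagrangian_subset[OF L'] by (simp_all add: lagrangian_def)
  obtain B where B: "subspace B" "B \<subseteq> L" "L \<inter> L' \<inter> B = {0}" "L \<inter> L' + B = L"
    "dim (L \<inter> L') + dim B = dim L"
    by (rule subspace_complement[OF subspace_inter[OF sub(1,2)] sub(1) inf_le1])
  have BS: "B \<subseteq> S"
    using B(2) sub(3) by blast
  have iB: "isotropic B"
    using isotropic_mono[OF lagrangian_isotropic[OF L] B(1,2)] .
  have "L \<subseteq> perp B"
    using perp_antimono[OF B(2)] sub(5) by simp
  have "subspace (absorb B L')"
    using lagrangian_absorb[OF L' iB] by (simp add: lagrangian_def)
  moreover have "L \<inter> L' \<subseteq> absorb B L'" "B \<subseteq> absorb B L'"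
    using subset_plus[of "L' \<inter> perp B" B] sub(2) B(1) subspace_perp[OF BS] \<open>L \<subseteq> perp B\<close>
    by (auto simp: absorb_def subspace_inter)
  ultimately have "L \<inter> L' + B \<subseteq> absorb B L'"
    using plus_subspace_subset by blast
  then have eq: "absorb B L' = L"
    using lagrangian_eqI[OF L lagrangian_absorb[OF L' iB]] B(4) by simp
  have "L' \<inter> B = {0}"
    using B(2,3) by blast
  then obtain d where d: "d > 0" "\<And>L''. gap_le d L'' L' \<Longrightarrow> gap_le e (absorb B L'') (absorb B L')"
    using absorb_continuous[OF L' B(1) BS _ e] by blast
  have "\<exists>L1. lagrangian L1 \<and> gap_le e L1 L \<and> dim L1 + dim (L \<inter> L') \<le> dim (L1 \<inter> L'') + dim L"
    if L'': "lagrangian L''" "gap_le d L'' L'" for L''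
  proof (intro exI conjI)
    show lag: "lagrangian (absorb B L'')"
      by (rule lagrangian_absorb[OF L''(1) iB])
    show "gap_le e (absorb B L'') L"
      using d(2)[OF L''(2)] eq by simp
    have "L'' \<inter> perp B \<subseteq> absorb B L'' \<inter> L''"
      using subset_plus(1)[of "L'' \<inter> perp B" B] B(1) subspace_perp[OF BS] L''(1)
      by (auto simp: absorb_def lagrangian_def subspace_inter)
    then have "dim (L'' \<inter> perp B) \<le> dim (absorb B L'' \<inter> L'')"
      by (rule dim_subset)
    moreover have "dim (L'' \<inter> perp B) + dim B \<ge> dim L''"
      using dim_Int_perp[OF L''(1) B(1) BS] by simp
    ultimately show "dim (absorb B L'') + dim (L \<inter> L') \<le> dim (absorb B L'' \<inter> L'') + dim L"
      using dim_lagrangian[OF lag] dim_lagrangian[OF L''(1)] B(5) by linarith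
  qed
  then show ?thesis
    using that d(1) by blast
qed

lemma form_bounded:
  assumes w: "w \<in> S"
  obtains K where "K > 0" "\<And>x. x \<in> S \<Longrightarrow> \<bar>\<omega> x w\<bar> \<le> K * norm x"
proof -
  obtain P where P: "linear P" "\<And>x. P x \<in> S"
    "\<And>x y. y \<in> S \<Longrightarrow> norm (x - P x) \<le> norm (x - y)" "\<And>x. x \<in> S \<Longrightarrow> P x = x"
    by (rule orthogonal_projection_exists[OF subspace_S]) blast
  have "linear (\<lambda>x. \<omega> (P x) w)"
    using P(1,2) w by (intro linearI) (simp_all add: linear_add linear_scale form_add_left form_scale_left)
  then obtain K where K: "K > 0" "\<And>x. norm (\<omega> (P x) w) \<le> norm x * K"
    using bounded_linear.pos_bounded[of "\<lambda>x. \<omega> (P x) w"] by (auto simp: linear_conv_bounded_linear)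
  have "\<bar>\<omega> x w\<bar> \<le> K * norm x" if "x \<in> S" for x
    using K(2)[of x] P(4)[OF that] by (simp add: mult.commute)
  then show ?thesis
    using that K(1) by blast
qed

text \<open>
  The Hamiltonian flow of the quadratic function \<open>x \<mapsto> \<omega> x u * \<omega> x w\<close> at time \<open>t\<close>, up to the sign of
  \<open>t\<close>, provided that \<open>\<omega> w u = 0\<close>: then the exponential series stops after the linear term.
\<close>

definition shear :: "'a \<Rightarrow> 'a \<Rightarrow> real \<Rightarrow> 'a \<Rightarrow> 'a" where
  "shear u w t x = x + t *\<^sub>R (\<omega> x u *\<^sub>R w + \<omega> x w *\<^sub>R u)"

lemma shear_in: "u \<in> S \<Longrightarrow> w \<in> S \<Longrightarrow> x \<in> S \<Longrightarrow> shear u w t x \<in> S"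
  using subspace_S by (simp add: shear_def subspace_add subspace_scale)

text \<open>The linear map that is multiplied by \<open>t\<close> squares to zero, because it vanishes on \<open>u\<close> and \<open>w\<close>.\<close>

lemma shear_inverse:
  assumes S: "u \<in> S" "w \<in> S" "x \<in> S" and uw: "\<omega> w u = 0"
  shows "shear u w t (shear u w (- t) x) = x"
proof -
  define z where "z = \<omega> x u *\<^sub>R w + \<omega> x w *\<^sub>R u"
  have wu: "\<omega> u w = 0"
    using form_flip[OF S(1,2)] uw by simp
  have zS: "z \<in> S" "(- t) *\<^sub>R z \<in> S"
    using S subspace_S by (simp_all add: z_def subspace_add subspace_scale subspace_neg)
  have sc: "a *\<^sub>R u \<in> S" "a *\<^sub>R w \<in> S" for a
    using S subspace_S by (simp_all add: subspace_scale)
  have "\<omega> z u = 0" "\<omega> z w = 0"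
    using S sc uw wu by (simp_all add: z_def form_add_left form_scale_left form_self)
  then have "\<omega> (x + (- t) *\<^sub>R z) u = \<omega> x u" "\<omega> (x + (- t) *\<^sub>R z) w = \<omega> x w"
    using S zS form_scale_left[OF zS(1) S(1), of "- t"] form_scale_left[OF zS(1) S(2), of "- t"]
      form_add_left[OF S(3) zS(2) S(1)] form_add_left[OF S(3) zS(2) S(2)] by simp_all
  then show ?thesis
    unfolding shear_def z_def[symmetric] by (simp add: z_def[symmetric])
qed

text \<open>
  The terms of first order in \<open>t\<close> cancel by antisymmetry, and the term of second order vanishes because
  \<open>u\<close> and \<open>w\<close> span an isotropic subspace.
\<close>

lemma shear_form:
  assumes S: "u \<in> S" "w \<in> S" "x \<in> S" "y \<in> S" and uw: "\<omega> w u = 0"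
  shows "\<omega> (shear u w t x) (shear u w t y) = \<omega> x y"
proof -
  have wu: "\<omega> u w = 0"
    using form_flip[OF S(1,2)] uw by simp
  define z where "z x = \<omega> x u *\<^sub>R w + \<omega> x w *\<^sub>R u" for x
  have sc: "a *\<^sub>R u \<in> S" "a *\<^sub>R w \<in> S" for a
    using S subspace_S by (simp_all add: subspace_scale)
  have zS: "z a \<in> S" "t *\<^sub>R z a \<in> S" for a
    using sc subspace_S by (simp_all add: z_def subspace_add subspace_scale)
  have left: "\<omega> (z a) b = \<omega> a u * \<omega> w b + \<omega> a w * \<omega> u b" if "b \<in> S" for a b
    using S sc that by (simp add: z_def form_add_left form_scale_left)
  have "\<omega> (x + t *\<^sub>R z x) (y + t *\<^sub>R z y) =
      \<omega> x y + t * \<omega> x (z y) + (t * \<omega> (z x) y + t * (t * \<omega> (z x) (z y)))"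
    using S zS subspace_S
    by (simp add: form_add_left form_add_right form_scale_left form_scale_right subspace_add
        algebra_simps)
  also have "\<omega> x (z y) = - \<omega> (z y) x"
    using form_flip S zS by blast
  also have "\<omega> (z x) (z y) = \<omega> x u * \<omega> w (z y) + \<omega> x w * \<omega> u (z y)"
    using left zS by blast
  also have "\<omega> w (z y) = 0"
    using S sc uw by (simp add: z_def form_add_right form_scale_right form_self)
  also have "\<omega> u (z y) = 0"
    using S sc wu by (simp add: z_def form_add_right form_scale_right form_self)
  finally have expand: "\<omega> (x + t *\<^sub>R z x) (y + t *\<^sub>R z y) = \<omega> x y + t * (\<omega> (z x) y - \<omega> (z y) x)"
    by (simp add: right_diff_distrib)
  have "\<omega> (z x) y = \<omega> (z y) x"
    unfolding left[OF S(3)] left[OF S(4)] form_flip[OF S(1,3)] form_flip[OF S(2,3)]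
      form_flip[OF S(1,4)] form_flip[OF S(2,4)] by simp
  then show ?thesis
    using expand by (simp add: shear_def z_def)
qed

lemma lagrangian_shear:
  assumes S: "u \<in> S" "w \<in> S" and uw: "\<omega> w u = 0" and L: "lagrangian L"
  shows "lagrangian (shear u w t ` L)"
proof -
  have LS: "L \<subseteq> S" "perp L = L"
    using L lagrangian_subset by (simp_all add: lagrangian_def)
  let ?g = "shear u w t"
  have gS: "?g ` L \<subseteq> S"
    using LS(1) shear_in S by blast
  have "perp (?g ` L) = ?g ` L"
  proof
    show "?g ` L \<subseteq> perp (?g ` L)"
    proof
      fix a assume "a \<in> ?g ` L"
      then obtain x where x: "a = ?g x" "x \<in> L"
        by blast
      have "\<omega> a (?g y) = 0" if "y \<in> L" for y
        using shear_form[OF S _ _ uw, of x y t] x that LS perpD[of x L y] by auto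
      then show "a \<in> perp (?g ` L)"
        using gS x by (auto simp: perp_def)
    qed
    show "perp (?g ` L) \<subseteq> ?g ` L"
    proof
      fix a assume a: "a \<in> perp (?g ` L)"
      then have aS: "a \<in> S"
        using perp_subset by blast
      define x where "x = shear u w (- t) a"
      have x: "x \<in> S" "?g x = a"
        using shear_in[OF S aS] shear_inverse[OF S aS uw] by (simp_all add: x_def)
      have "\<omega> x y = 0" if "y \<in> L" for y
        using shear_form[OF S x(1) _ uw, of y t] x(2) that LS(1) perpD[OF a, of "?g y"] by auto
      then have "x \<in> perp L"
        using x(1) by (simp add: perp_def)
      then show "a \<in> ?g ` L"
        using x(2) LS(2) by blast
    qed
  qed
  then show ?thesis
    using subspace_perp[OF gS] by (simp add: lagrangian_def)
qed

lemma shear_near: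
  assumes S: "u \<in> S" "w \<in> S" and L: "L \<subseteq> S" and e: "e > 0"
  obtains t where "t > 0" "gap_le e (shear u w t ` L) L"
proof -
  obtain K where K: "K > 0" "\<And>x. x \<in> S \<Longrightarrow> \<bar>\<omega> x u\<bar> \<le> K * norm x"
    using form_bounded[OF S(1)] by blast
  obtain J where J: "J > 0" "\<And>x. x \<in> S \<Longrightarrow> \<bar>\<omega> x w\<bar> \<le> J * norm x"
    using form_bounded[OF S(2)] by blast
  define H where "H = K * norm w + J * norm u + 1"
  have H: "H > 0"
    using K(1) J(1) by (simp add: H_def add_nonneg_pos)
  have bound: "norm (\<omega> x u *\<^sub>R w + \<omega> x w *\<^sub>R u) \<le> H * norm x" if "x \<in> S" for x
  proof -
    have "norm (\<omega> x u *\<^sub>R w + \<omega> x w *\<^sub>R u) \<le> \<bar>\<omega> x u\<bar> * norm w + \<bar>\<omega> x w\<bar> * norm u"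
      using norm_triangle_ineq[of "\<omega> x u *\<^sub>R w" "\<omega> x w *\<^sub>R u"] by simp
    also have "\<dots> \<le> (K * norm x) * norm w + (J * norm x) * norm u"
      using K(2) J(2) that by (intro add_mono mult_right_mono) auto
    also have "\<dots> \<le> H * norm x"
      by (simp add: H_def algebra_simps)
    finally show ?thesis .
  qed
  define t where "t = min (e / 2) (1/2) / H"
  have t: "t > 0" "t * H = min (e / 2) (1/2)"
    using e H by (auto simp: t_def)
  have "gap_le e (shear u w t ` L) L"
    unfolding gap_le_def
  proof
    fix a assume "a \<in> shear u w t ` L"
    then obtain x where x: "x \<in> L" "a = shear u w t x"
      by blast
    have "norm (a - x) = t * norm (\<omega> x u *\<^sub>R w + \<omega> x w *\<^sub>R u)"
      using t(1) x(2) by (simp add: shear_def)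
    also have "\<dots> \<le> t * (H * norm x)"
      using bound x(1) L t(1) by (intro mult_left_mono) auto
    also have "\<dots> = min (e / 2) (1/2) * norm x"
      using t(2) by (metis mult.assoc)
    finally have "norm (a - x) \<le> min (e / 2) (1/2) * norm x" .
    moreover have "min (e / 2) (1/2) * norm x \<le> 1/2 * norm x" "min (e / 2) (1/2) * norm x \<le> e/2 * norm x"
      by (intro mult_right_mono; simp)+
    ultimately have *: "norm x \<le> 2 * norm a" "norm (a - x) \<le> e/2 * norm x"
      using norm_triangle_ineq2[of x a] by (simp_all add: norm_minus_commute)
    have "e / 2 * norm x \<le> e / 2 * (2 * norm a)"
      using *(1) e by (intro mult_left_mono) auto
    then have "norm (a - x) \<le> e * norm a"
      using *(2) by simp
    then show "\<exists>y\<in>L. norm (a - y) \<le> e * norm a"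
      using x(1) by blast
  qed
  then show ?thesis
    using that t(1) by blast
qed

end


section \<open>Reduction to a symplectic complement\<close>

lemma (in symplectic_subspace) dim_Int_perp_ge:
  assumes "subspace W" "W \<subseteq> S" "subspace B" "B \<subseteq> S"
  shows "dim W \<le> dim (W \<inter> perp B) + dim B"
proof -
  have "dim (W + perp B) \<le> dim S"
    using assms perp_subset subspace_S by (intro dim_subset plus_subspace_subset)
  then show ?thesis
    using dim_plus_Int[OF assms(1) subspace_perp[OF assms(4)]] dim_perp[OF assms(3,4)] by simp
qed

locale symplectic_splitting = symplectic_subspace S \<omega>
  for S :: "'a::euclidean_space set" and \<omega> :: "'a \<Rightarrow> 'a \<Rightarrow> real" +
  fixes Y :: "'a set"
  assumes subspace_Y: "subspace Y" and Y_subset: "Y \<subseteq> S" and Y_nondegenerate: "Y \<inter> perp Y = {0}"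
begin

lemma symplectic_subspace_Y: "symplectic_subspace Y \<omega>"
proof
  have "x = 0" if "x \<in> Y" "\<forall>y\<in>Y. \<omega> x y = 0" for x
    using that Y_subset Y_nondegenerate by (auto simp: perp_def)
  then show "symplectic_form_on Y \<omega>"
    using symplectic_form Y_subset unfolding symplectic_form_on_def by (meson subsetD)
qed (rule subspace_Y)

sublocale Y: symplectic_subspace Y \<omega>
  by (rule symplectic_subspace_Y)

lemma Y_perp: "Y.perp W = Y \<inter> perp W"
  using Y_subset by (auto simp: Y.perp_def perp_def)

lemma Y_lagrangian_isotropic: "Y.lagrangian M \<Longrightarrow> isotropic M"
  using Y_perp[of M] by (auto simp: Y.lagrangian_def isotropic_def)

text \<open>
  The isotropic subspaces \<open>D\<close> orthogonal to \<open>Y\<close> for which \<open>Y\<close> is a model of \<open>D\<^sup>\<bottom> / D\<close>; the dimension formula says that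
  \<open>Y\<close> is as large as this quotient.
\<close>

definition reducing :: "'a set \<Rightarrow> bool" where
  "reducing D \<longleftrightarrow> isotropic D \<and> D \<subseteq> perp Y \<and> dim Y + 2 * dim D = dim S"

text \<open>
  The reduction \<open>(L \<inter> D\<^sup>\<bottom>) / (L \<inter> D)\<close>, transported to \<open>Y\<close>. As several subspaces \<open>D\<close> have the same
  model \<open>Y\<close>, their reductions can be compared.
\<close>

definition reduction :: "'a set \<Rightarrow> 'a set \<Rightarrow> 'a set" where
  "reduction D L = absorb D L \<inter> Y"

lemma reducingD:
  assumes "reducing D"
  shows "isotropic D" "subspace D" "D \<subseteq> S" "D \<subseteq> perp Y" "dim Y + 2 * dim D = dim S"
  using assms isotropic_subset[of D] by (simp_all add: reducing_def isotropic_def)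

lemma reducing_perp:
  assumes "reducing D"
  shows "perp D = Y + D" "Y \<inter> D = {0}"
proof -
  note D = reducingD[OF assms]
  show 0: "Y \<inter> D = {0}"
    using D(2,4) Y_nondegenerate subspace_Y subspace_0 by blast
  have "Y + D \<subseteq> perp D"
    using D perp_sym[OF Y_subset D(4)] subspace_perp[OF D(3)]
    by (intro plus_subspace_subset) (auto simp: isotropic_def)
  moreover have "dim (perp D) \<le> dim (Y + D)"
    using dim_plus_direct[OF subspace_Y D(2) 0] dim_perp[OF D(2,3)] D(5) by simp
  ultimately show "perp D = Y + D"
    using subspace_dim_equal[OF subspace_plus[OF subspace_Y D(2)] subspace_perp[OF D(3)]] by simp
qed

text \<open>
  \<open>absorb D L\<close> lies between \<open>D\<close> and \<open>D\<^sup>\<bottom> = Y \<oplus> D\<close>, so by the modular law its intersection with \<open>Y\<close> has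
  half the dimension of \<open>Y\<close>.
\<close>

lemma lagrangian_reduction:
  assumes D: "reducing D" and L: "lagrangian L"
  shows "Y.lagrangian (reduction D L)"
proof (rule Y.lagrangianI)
  note d = reducingD[OF D]
  have P: "lagrangian (absorb D L)" "subspace (absorb D L)" "perp (absorb D L) = absorb D L"
    using lagrangian_absorb[OF L d(1)] by (simp_all add: lagrangian_def)
  have "L \<inter> perp D \<subseteq> perp D" "D \<subseteq> perp D"
    using d(1) by (auto simp: isotropic_def)
  then have "absorb D L \<subseteq> Y + D"
    using plus_subspace_subset[of "L \<inter> perp D" "perp D" D] subspace_perp[OF d(3)] reducing_perp(1)[OF D]
    by (simp add: absorb_def)
  moreover have "D \<subseteq> absorb D L"
    using subset_plus(2)[of "L \<inter> perp D" D] L d subspace_perp[OF d(3)]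
    by (simp add: absorb_def lagrangian_def subspace_inter)
  ultimately have "dim (reduction D L) + dim D = dim (absorb D L)"
    using dim_Int_modular[OF d(2) subspace_Y P(2) _ _ reducing_perp(2)[OF D]]
    by (simp add: reduction_def)
  then show "dim Y \<le> 2 * dim (reduction D L)"
    using dim_lagrangian[OF P(1)] d(5) by simp
  have "reduction D L \<subseteq> perp (reduction D L)"
    using P(3) perp_antimono[of "reduction D L" "absorb D L"] by (auto simp: reduction_def)
  then show "Y.isotropic (reduction D L)"
    using P(2) subspace_Y by (auto simp: Y.isotropic_def Y_perp reduction_def subspace_inter)
qed

lemma mem_reduction:
  assumes D: "reducing D" and L: "lagrangian L"
  shows "y \<in> reduction D L \<longleftrightarrow> y \<in> Y \<and> (\<exists>d\<in>D. y + d \<in> L)"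
proof -
  note d = reducingD[OF D]
  have sub: "subspace L" "subspace D"
    using L d by (simp_all add: lagrangian_def)
  have "y \<in> absorb D L \<longleftrightarrow> (\<exists>d\<in>D. y + d \<in> L)" if y: "y \<in> Y"
  proof
    assume "y \<in> absorb D L"
    then obtain l d' where "y = l + d'" "l \<in> L" "d' \<in> D"
      by (auto simp: absorb_def set_plus_def)
    then show "\<exists>d\<in>D. y + d \<in> L"
      using sub by (intro bexI[of _ "- d'"]) (auto intro: subspace_neg)
  next
    assume "\<exists>d\<in>D. y + d \<in> L"
    then obtain d' where d': "d' \<in> D" "y + d' \<in> L"
      by blast
    have "y + d' \<in> perp D"
      using y d'(1) reducing_perp(1)[OF D] by auto
    then have "(y + d') + - d' \<in> absorb D L"
      unfolding absorb_def using d' sub by (intro set_plus_intro) (auto intro: subspace_neg)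
    then show "y \<in> absorb D L"
      by simp
  qed
  then show ?thesis
    by (auto simp: reduction_def)
qed

text \<open>
  Without excess \<open>L \<inter> D\<^sup>\<bottom>\<close> is transversal to \<open>D\<close>. This is what makes adding \<open>D\<close> continuous.
\<close>

lemma reduction_continuous:
  assumes D: "reducing D" and L: "lagrangian L" and "L \<inter> D = {0}" and e: "e > 0"
  obtains d where "d > 0" "\<And>L'. gap_le d L' L \<Longrightarrow> gap_le e (reduction D L') (reduction D L)"
proof -
  note d = reducingD[OF D]
  have "subspace (absorb D L)"
    using lagrangian_absorb[OF L d(1)] by (simp add: lagrangian_def)
  then obtain d1 where d1: "d1 > 0" "\<And>P. gap_le d1 P (absorb D L) \<Longrightarrow> gap_le e (P \<inter> Y) (absorb D L \<inter> Y)"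
    using gap_le_Int[OF _ subspace_Y e] by blast
  obtain d2 where d2: "d2 > 0" "\<And>L'. gap_le d2 L' L \<Longrightarrow> gap_le d1 (absorb D L') (absorb D L)"
    using absorb_continuous[OF L d(2,3) assms(3) d1(1)] by blast
  show ?thesis
    using that[OF d2(1)] d1(2) d2(2) by (simp add: reduction_def)
qed

end

text \<open>
  The decomposition \<open>Y \<oplus> D \<oplus> D'\<close> of \<open>S\<close>, in which \<open>D\<close> and \<open>D'\<close> are dual to each other and orthogonal to
  \<open>Y\<close>.
\<close>

locale coisotropic_splitting = symplectic_splitting S \<omega> Y
  for S :: "'a::euclidean_space set" and \<omega> :: "'a \<Rightarrow> 'a \<Rightarrow> real" and Y :: "'a set" +
  fixes D D' :: "'a set"
  assumes reducing_D: "reducing D" and reducing_D': "reducing D'" and D_Int_D': "D \<inter> D' = {0}"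
begin

lemmas D = reducingD[OF reducing_D]
  and D' = reducingD[OF reducing_D']

lemma splitting_unique:
  assumes "y \<in> Y" "d \<in> D" "d' \<in> D'" "y + d + d' \<in> D"
  shows "y = 0" "d' = 0"
proof -
  have P: "subspace (perp Y)"
    by (rule subspace_perp[OF Y_subset])
  have "y + d + d' - d - d' \<in> perp Y"
    using assms D(4) D'(4) P by (blast intro: subspace_diff)
  then show y: "y = 0"
    using assms(1) Y_nondegenerate by auto
  have "y + d + d' - d \<in> D"
    using assms(2,4) D(2) by (blast intro: subspace_diff)
  then show "d' = 0"
    using assms(3) y D_Int_D' by auto
qed

lemma D_Int_perp_D': "D \<inter> perp D' = {0}"
proof -
  have "x = 0" if x: "x \<in> D" "x \<in> perp D'" for x
  proof -
    obtain y d' where "x = y + d'" "y \<in> Y" "d' \<in> D'"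
      using x(2) reducing_perp(1)[OF reducing_D'] by (auto simp: set_plus_def)
    then show ?thesis
      using splitting_unique[of y 0 d'] x(1) D(2) by (simp add: subspace_0)
  qed
  then show ?thesis
    using D(2) D'(3) subspace_perp subspace_0 by blast
qed

lemma D'_Int_perp_D: "D' \<inter> perp D = {0}"
proof -
  have "x = 0" if x: "x \<in> D'" "x \<in> perp D" for x
  proof -
    obtain y d where yd: "x = y + d" "y \<in> Y" "d \<in> D"
      using x(2) reducing_perp(1)[OF reducing_D] by (auto simp: set_plus_def)
    have "y + d + - x \<in> D"
      using yd(1) D(2) by (simp add: subspace_0)
    then show ?thesis
      using splitting_unique(2)[OF yd(2,3), of "- x"] x(1) D'(2) by (simp add: subspace_neg)
  qed
  then show ?thesis
    using D'(2) D(3) subspace_perp subspace_0 by blast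
qed

text \<open>
  For \<open>E \<subseteq> D\<close> the sum of \<open>E\<close> and its annihilator in \<open>D'\<close> is again a reducing subspace. This family
  interpolates between \<open>D'\<close> (for \<open>E = 0\<close>) and \<open>D\<close> (for \<open>E = D\<close>).
\<close>

lemma mixed_Int_perp_D:
  assumes E: "subspace E" "E \<subseteq> D"
  shows "absorb E D' \<inter> perp D = E"
proof
  have DpD: "D \<subseteq> perp D"
    using D(1) by (simp add: isotropic_def)
  have ES: "E \<subseteq> S"
    using E(2) D(3) by blast
  show "E \<subseteq> absorb E D' \<inter> perp D"
    using subset_plus(2)[of "D' \<inter> perp E" E] D'(2) E DpD subspace_perp[OF ES]
    by (auto simp: absorb_def subspace_inter)
  show "absorb E D' \<inter> perp D \<subseteq> E"
  proof
    fix x assume x: "x \<in> absorb E D' \<inter> perp D"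
    then obtain d' e where de: "x = d' + e" "d' \<in> D'" "e \<in> E"
      by (auto simp: absorb_def set_plus_def)
    have "x - e \<in> perp D"
      using x de(3) E(2) DpD subspace_perp[OF D(3)] by (blast intro: subspace_diff)
    then have "d' = 0"
      using de D'_Int_perp_D by auto
    then show "x \<in> E"
      using de by simp
  qed
qed

lemma reducing_mixed:
  assumes E: "subspace E" "E \<subseteq> D"
  shows "reducing (absorb E D')"
  unfolding reducing_def
proof (intro conjI)
  have ES: "E \<subseteq> S"
    using E(2) D(3) by blast
  have sA: "subspace (D' \<inter> perp E)"
    using D'(2) subspace_perp[OF ES] by (rule subspace_inter)
  have iE: "isotropic E"
    using isotropic_mono[OF D(1) E] .
  show "isotropic (absorb E D')"
    unfolding absorb_def using isotropic_mono[OF D'(1) sA] iE by (rule isotropic_plus) auto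
  show "absorb E D' \<subseteq> perp Y"
    unfolding absorb_def using D(4) D'(4) E(2) subspace_perp[OF Y_subset]
    by (intro plus_subspace_subset) auto
  have spD': "subspace (perp D')" "perp D' \<subseteq> S"
    using subspace_perp[OF D'(3)] perp_subset by auto
  have "perp D' \<inter> E = {0}"
    using D_Int_perp_D' E subspace_0 spD'(1) by blast
  then have "dim (perp D' + E) = dim (perp D') + dim E"
    by (rule dim_plus_direct[OF spD'(1) E(1)])
  moreover have "D' \<inter> perp E = perp (perp D' + E)"
    using perp_plus[OF spD'(1) E(1) spD'(2) ES] perp_perp[OF D'(2,3)] by simp
  moreover have "dim (perp (perp D' + E)) + dim (perp D' + E) = dim S"
    by (rule dim_perp[OF subspace_plus[OF spD'(1) E(1)] plus_subspace_subset[OF spD'(2) ES subspace_S]])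
  ultimately have "dim (D' \<inter> perp E) + dim E = dim D'"
    using dim_perp[OF D'(2,3)] by simp
  moreover have "D' \<inter> perp E \<inter> E = {0}"
    using D_Int_D' E D'(2) subspace_perp[OF ES] subspace_0 by blast
  ultimately have "dim (absorb E D') = dim D'"
    unfolding absorb_def using dim_plus_direct[OF sA E(1)] by simp
  then show "dim Y + 2 * dim (absorb E D') = dim S"
    using D'(5) by simp
qed

text \<open>
  Since \<open>Y\<close> and \<open>N\<close> are orthogonal, \<open>M \<mapsto> M + N\<close> lifts the Lagrangians of \<open>Y\<close> to Lagrangians of \<open>S\<close>. It is a
  section of the reduction by \<open>D\<close>, and for \<open>N = absorb E D'\<close> its values have excess \<open>dim E\<close>.
\<close>

lemma section_lagrangian:
  assumes M: "Y.lagrangian M" and N: "reducing N"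
  shows "lagrangian (M + N)"
proof (rule lagrangianI)
  note n = reducingD[OF N]
  have m: "subspace M" "M \<subseteq> Y"
    using M Y.lagrangian_subset by (simp_all add: Y.lagrangian_def)
  have "M \<subseteq> perp N"
    using m(2) perp_sym[OF Y_subset n(4)] by blast
  then show "isotropic (M + N)"
    by (rule isotropic_plus[OF Y_lagrangian_isotropic[OF M] n(1)])
  have "M \<inter> N = {0}"
    using reducing_perp(2)[OF N] m n(2) subspace_0 by blast
  then show "dim S \<le> 2 * dim (M + N)"
    using dim_plus_direct[OF m(1) n(2)] Y.dim_lagrangian[OF M] n(5) by simp
qed

lemma section_reduction:
  assumes M: "Y.lagrangian M" and N: "reducing N"
  shows "reduction D (M + N) = M"
proof (rule sym, rule Y.lagrangian_eqI[OF M])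
  have L: "lagrangian (M + N)"
    by (rule section_lagrangian[OF M N])
  show "Y.lagrangian (reduction D (M + N))"
    by (rule lagrangian_reduction[OF reducing_D L])
  show "M \<subseteq> reduction D (M + N)"
  proof
    fix m assume m: "m \<in> M"
    have "m + 0 \<in> M + N"
      using m reducingD(2)[OF N] by (intro set_plus_intro) (auto simp: subspace_0)
    then have "\<exists>d\<in>D. m + d \<in> M + N"
      using subspace_0[OF D(2)] by blast
    then show "m \<in> reduction D (M + N)"
      using m Y.lagrangian_subset[OF M] mem_reduction[OF reducing_D L] by blast
  qed
qed

lemma section_Int_D:
  assumes M: "Y.lagrangian M" and E: "subspace E" "E \<subseteq> D"
  shows "(M + absorb E D') \<inter> D = E"
proof
  have m: "subspace M" "M \<subseteq> Y"
    using M Y.lagrangian_subset by (simp_all add: Y.lagrangian_def)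
  have sN: "subspace (absorb E D')"
    using reducingD(2)[OF reducing_mixed[OF E]] .
  show "E \<subseteq> (M + absorb E D') \<inter> D"
    using mixed_Int_perp_D[OF E] E(2) subset_plus(2)[OF m(1) sN] by blast
  show "(M + absorb E D') \<inter> D \<subseteq> E"
  proof
    fix x assume x: "x \<in> (M + absorb E D') \<inter> D"
    then obtain y d' e where de: "x = y + (d' + e)" "y \<in> M" "d' \<in> D'" "e \<in> E"
      unfolding absorb_def by (auto elim!: set_plus_elim)
    then have "y + e + d' \<in> D"
      using x by (simp add: algebra_simps)
    moreover have "y \<in> Y" "e \<in> D"
      using de(2,4) m(2) E(2) by auto
    ultimately have "y = 0" "d' = 0"
      using splitting_unique de(3) by blast+
    then show "x \<in> E"
      using de(1,4) by simp
  qed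
qed

text \<open>
  Let \<open>K = L \<inter> D\<close> and \<open>D = K \<oplus> E\<close>. The reducing subspace \<open>absorb E D'\<close> is transversal to \<open>L\<close>, and
  reducing \<open>L\<close> by it gives the same result as reducing by \<open>D\<close>. Hence its reduction of a nearby \<open>L'\<close> is
  close to the reduction of \<open>L\<close>. The two reductions of \<open>L'\<close> both contain the projection of
  \<open>L' \<inter> (Y \<oplus> E)\<close>, whose dimension is estimated by comparison with \<open>L' \<inter> (Y \<oplus> D)\<close>.
\<close>

lemma reduction_upper_semicontinuous:
  assumes L: "lagrangian L" and e: "e > 0"
  obtains d where "d > 0"
    "\<And>L'. lagrangian L' \<Longrightarrow> gap_le d L' L \<Longrightarrow>
      dim (L' \<inter> D) \<le> dim (L \<inter> D) \<and>
      (\<exists>M. Y.lagrangian M \<and> gap_le e M (reduction D L) \<and>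
        dim M + dim (L' \<inter> D) \<le> dim (M \<inter> reduction D L') + dim (L \<inter> D))"
proof -
  have sL: "subspace L" "perp L = L" "L \<subseteq> S"
    using L lagrangian_subset by (simp_all add: lagrangian_def)
  obtain E where E: "subspace E" "E \<subseteq> D" "L \<inter> D \<inter> E = {0}" "L \<inter> D + E = D"
    "dim (L \<inter> D) + dim E = dim D"
    by (rule subspace_complement[OF subspace_inter[OF sL(1) D(2)] D(2) inf_le2])
  let ?N = "absorb E D'"
  note N = reducing_mixed[OF E(1,2)]
  have EN: "E \<subseteq> ?N"
    using mixed_Int_perp_D[OF E(1,2)] by blast
  have ES: "E \<subseteq> S"
    using E(2) D(3) by blast
  have LE: "L \<inter> E = {0}"
    using E(2,3) by blast
  have "x = 0" if x: "x \<in> L" "x \<in> ?N" for x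
  proof -
    obtain d' f where f: "x = d' + f" "d' \<in> D'" "d' \<in> perp E" "f \<in> E"
      using x(2) by (auto simp: absorb_def set_plus_def)
    have "L \<subseteq> perp (L \<inter> D)" "D \<subseteq> perp (L \<inter> D)"
      using sL(2) D(1) perp_antimono[of "L \<inter> D" L] perp_antimono[of "L \<inter> D" D]
      by (auto simp: isotropic_def)
    moreover have "subspace (perp (L \<inter> D))"
      using D(3) by (intro subspace_perp) blast
    ultimately have "x - f \<in> perp (L \<inter> D)"
      using x(1) f(4) E(2) by (blast intro: subspace_diff)
    then have "d' \<in> perp (L \<inter> D + E)"
      using perp_plus[OF subspace_inter[OF sL(1) D(2)] E(1) _ ES] f sL(3) by auto
    then have "d' = 0"
      using E(4) f(2) D'_Int_perp_D by auto
    then show ?thesis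
      using x(1) f LE by auto
  qed
  then have LN: "L \<inter> ?N = {0}"
    using sL(1) reducingD(2)[OF N] subspace_0 by blast
  have eq: "reduction D L = reduction ?N L"
  proof (rule Y.lagrangian_eqI)
    show "Y.lagrangian (reduction D L)" "Y.lagrangian (reduction ?N L)"
      using lagrangian_reduction[OF _ L] reducing_D N by auto
    show "reduction D L \<subseteq> reduction ?N L"
    proof
      fix y assume "y \<in> reduction D L"
      then obtain d where y: "y \<in> Y" "d \<in> D" "y + d \<in> L"
        using mem_reduction[OF reducing_D L] by blast
      then obtain c f where "d = c + f" "c \<in> L" "f \<in> E"
        using E(4) by (metis IntD1 set_plus_elim)
      moreover from this have "y + d - c \<in> L"
        using y(3) sL(1) by (blast intro: subspace_diff)
      ultimately show "y \<in> reduction ?N L"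
        using y(1) EN mem_reduction[OF N L] by auto
    qed
  qed
  obtain d1 where d1: "d1 > 0" "\<And>L'. gap_le d1 L' L \<Longrightarrow> gap_le e (reduction ?N L') (reduction ?N L)"
    using reduction_continuous[OF N L LN e] by blast
  obtain d2 where d2: "d2 > 0" "\<And>L'. gap_le d2 L' L \<Longrightarrow> gap_le (1/2) (L' \<inter> E) (L \<inter> E)"
    using gap_le_Int[OF sL(1) E(1), of "1/2"] by auto
  have main: "dim (L' \<inter> D) \<le> dim (L \<inter> D) \<and>
      (\<exists>M. Y.lagrangian M \<and> gap_le e M (reduction D L) \<and>
        dim M + dim (L' \<inter> D) \<le> dim (M \<inter> reduction D L') + dim (L \<inter> D))"
    if L': "lagrangian L'" and gap: "gap_le (min d1 d2) L' L" for L'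
  proof (intro conjI exI)
    have sL': "subspace L'" "L' \<subseteq> S"
      using L' lagrangian_subset by (simp_all add: lagrangian_def)
    have "gap_le (1/2) (L' \<inter> E) {0}"
      using d2(2)[OF gap_le_mono[OF gap]] LE by simp
    then have L'E: "L' \<inter> E = {0}"
      using gap_le_zero_iff[of "1/2" "L' \<inter> E"] sL'(1) E(1) subspace_0 by auto
    have sub: "subspace (L' \<inter> D)" "subspace (Y + E)" "subspace (perp D)"
      using sL'(1) D E(1) subspace_Y subspace_perp by (simp_all add: subspace_inter subspace_plus)
    have "L' \<inter> D \<inter> E = {0}"
      using L'E E(2) by blast
    then have "dim (L' \<inter> D + E) = dim (L' \<inter> D) + dim E"
      by (rule dim_plus_direct[OF sub(1) E(1)])
    moreover have "dim (L' \<inter> D + E) \<le> dim D"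
      using E(2) D(2) by (intro dim_subset plus_subspace_subset) auto
    ultimately show "dim (L' \<inter> D) \<le> dim (L \<inter> D)"
      using E(5) by simp
    let ?M = "reduction ?N L'"
    show M: "Y.lagrangian ?M"
      by (rule lagrangian_reduction[OF N L'])
    show "gap_le e ?M (reduction D L)"
      using d1(2)[OF gap_le_mono[OF gap]] eq by simp
    let ?Q = "L' \<inter> (Y + E)"
    have YE: "Y + E \<subseteq> perp D"
      unfolding reducing_perp(1)[OF reducing_D] by (rule set_plus_mono2[OF subset_refl E(2)])
    have "L' \<inter> perp D \<inter> (Y + E) = ?Q"
      using YE by blast
    then have "dim (L' \<inter> perp D + (Y + E)) + dim ?Q = dim (L' \<inter> perp D) + dim (Y + E)"
      using dim_plus_Int[OF subspace_inter[OF sL'(1) sub(3)] sub(2)] by simp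
    moreover have "dim (L' \<inter> perp D + (Y + E)) \<le> dim (perp D)"
      by (rule dim_subset[OF plus_subspace_subset[OF inf_le2 YE sub(3)]])
    moreover have "dim (perp D) + dim D = dim S"
      by (rule dim_perp[OF D(2,3)])
    moreover have "Y \<inter> E = {0}"
      using reducing_perp(2)[OF reducing_D] E(1,2) subspace_Y subspace_0 by blast
    then have "dim (Y + E) = dim Y + dim E"
      by (rule dim_plus_direct[OF subspace_Y E(1)])
    ultimately have Q: "dim ?Q + dim S \<ge> dim (L' \<inter> perp D) + dim D + dim Y + dim E"
      by linarith
    have sQ: "subspace ?Q"
      using sL'(1) sub(2) by (rule subspace_inter)
    have "?Q \<inter> E = {0}"
      using L'E subset_plus(2)[OF subspace_Y E(1)] by blast
    then have "dim (?Q + E) = dim ?Q + dim E"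
      by (rule dim_plus_direct[OF sQ E(1)])
    moreover have "dim ((?Q + E) \<inter> Y) + dim E = dim (?Q + E)"
      using sQ E(1) subset_plus(2)[OF sQ E(1)] subset_plus(2)[OF subspace_Y E(1)] sub(2) \<open>Y \<inter> E = {0}\<close>
      by (intro dim_Int_modular subspace_Y subspace_plus plus_subspace_subset) auto
    moreover have "(?Q + E) \<inter> Y \<subseteq> ?M \<inter> reduction D L'"
    proof
      fix y assume y: "y \<in> (?Q + E) \<inter> Y"
      then obtain q f where "y = q + f" "q \<in> L'" "f \<in> E"
        by (auto elim!: set_plus_elim)
      then have "- f \<in> E" "y + - f \<in> L'"
        using E(1) by (auto simp: subspace_neg)
      then show "y \<in> ?M \<inter> reduction D L'"
        using y E(2) EN mem_reduction[OF N L'] mem_reduction[OF reducing_D L'] by blast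
    qed
    then have "dim ((?Q + E) \<inter> Y) \<le> dim (?M \<inter> reduction D L')"
      by (rule dim_subset)
    ultimately show "dim ?M + dim (L' \<inter> D) \<le> dim (?M \<inter> reduction D L') + dim (L \<inter> D)"
      using Q dim_Int_perp[OF L' D(2,3)] dim_lagrangian[OF L'] Y.dim_lagrangian[OF M] D(5) E(5)
      by linarith
  qed
  show ?thesis
    using that[of "min d1 d2"] d1(1) d2(1) main by simp
qed

end


section \<open>Lowering the excess\<close>

context coisotropic_splitting
begin

text \<open>
  The section \<open>M + absorb K D'\<close> is moved by a small shear. Let \<open>u \<in> D'\<close> not annihilate \<open>K\<close>. The shear
  along \<open>u\<close> and \<open>w = u\<close> fixes \<open>M\<close> and pushes one direction of \<open>K\<close> out of \<open>Y \<oplus> D\<close>, towards \<open>u\<close>. The shear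
  along \<open>u\<close> and \<open>w = v \<in> Y\<close> pushes the same direction of \<open>K\<close> towards \<open>v\<close> instead, which adds \<open>v\<close> to the
  reduction, while the vectors of \<open>M\<close> that are not orthogonal to \<open>v\<close> leave \<open>Y \<oplus> D\<close>. In both cases the
  intersection with \<open>D\<close> shrinks from \<open>K\<close> to \<open>K \<inter> u\<^sup>\<bottom>\<close>.
\<close>

lemma excess_lowering:
  assumes M: "Y.lagrangian M" and K: "subspace K" "K \<subseteq> D" "dim K = Suc j"
    and M': "M' = M \<or> (\<exists>v\<in>Y. v \<notin> M \<and> M' = Y.absorb (span {v}) M)" and e: "e > 0"
  obtains L where "lagrangian L" "gap_le e L (M + absorb K D')" "reduction D L = M'" "dim (L \<inter> D) = j"
proof -
  note result = that
  let ?N = "absorb K D'"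
  define L0 where "L0 = M + ?N"
  note N = reducing_mixed[OF K(1,2)]
  have L0: "lagrangian L0"
    unfolding L0_def by (rule section_lagrangian[OF M N])
  have L0S: "L0 \<subseteq> S"
    by (rule lagrangian_subset[OF L0])
  have m: "subspace M" "M \<subseteq> Y"
    using M Y.lagrangian_subset by (simp_all add: Y.lagrangian_def)
  have KS: "K \<subseteq> S"
    using K(2) D(3) by blast
  have "\<not> D' \<subseteq> perp K"
  proof
    assume "D' \<subseteq> perp K"
    then have "K \<subseteq> perp D'"
      by (rule perp_sym[OF KS])
    then have "K \<subseteq> {0}"
      using K(2) D_Int_perp_D' by blast
    then have "dim K = 0"
      by (simp add: dim_eq_0)
    then show False
      using K(3) by simp
  qed
  then obtain u where u: "u \<in> D'" "u \<notin> perp K"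
    by blast
  have uS: "u \<in> S" "u \<in> perp Y"
    using u(1) D'(3,4) by auto
  obtain k0 where k0: "k0 \<in> K" "\<omega> k0 u \<noteq> 0"
    using u(2) uS(1) KS form_flip by (fastforce simp: perp_def)
  define K1 where "K1 = K \<inter> perp (span {u})"
  have mem_K1: "k \<in> K1 \<longleftrightarrow> k \<in> K \<and> \<omega> k u = 0" for k
    using KS uS(1) by (auto simp: K1_def perp_def span_singleton form_scale_right)
  have spu: "span {u} \<subseteq> S"
    using uS(1) subspace_S by (intro span_minimal) auto
  have sK1: "subspace K1" "K1 \<subseteq> K"
    using K(1) subspace_perp[OF spu] by (auto simp: K1_def subspace_inter)
  have "dim K \<le> dim K1 + dim (span {u})"
    unfolding K1_def by (rule dim_Int_perp_ge[OF K(1) KS subspace_span spu])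
  moreover have "dim (span {u}) \<le> 1"
    by (simp add: dim_span)
  moreover have "\<not> dim K \<le> dim K1"
    using subspace_dim_equal[OF sK1(1) K(1) sK1(2)] k0 mem_K1 by blast
  ultimately have dim_K1: "dim K1 = j"
    using K(3) by linarith
  have decompose: "\<exists>y\<in>M. \<exists>d'\<in>D'. \<exists>k\<in>K. x = y + k + d' \<and> d' \<in> perp K \<and> \<omega> x u = \<omega> k u"
    if "x \<in> L0" for x
  proof -
    obtain y d' k where x: "x = y + (d' + k)" "y \<in> M" "d' \<in> D'" "d' \<in> perp K" "k \<in> K"
      using \<open>x \<in> L0\<close> unfolding L0_def absorb_def by (auto elim!: set_plus_elim)
    have "\<omega> y u = 0" "\<omega> d' u = 0"
      using perpD2[OF uS(2), of y] x(2) m(2) Y_subset D'(1) x(3) u(1)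
      by (auto simp: isotropic_def perp_def)
    then have "\<omega> x u = \<omega> k u"
      using x m(2) Y_subset D'(3) KS uS(1) subspace_S
      by (auto simp: form_add_left subspace_add subset_iff)
    then show ?thesis
      using x by (metis add.assoc add.commute)
  qed
  have in_L0: "y + k \<in> L0" if "y \<in> M" "k \<in> K" for y k
    unfolding L0_def using that mixed_Int_perp_D[OF K(1,2)] by (intro set_plus_intro) auto
  have inL0_form: "\<omega> (y + k) u = \<omega> k u" if "y \<in> M" "k \<in> K" for y k
    using perpD2[OF uS(2), of y] that m(2) Y_subset KS uS(1)
    by (auto simp: form_add_left subset_iff)
  have finish: thesis
    if w: "w \<in> S" "\<omega> w u = 0"
      and K1: "\<And>k. k \<in> K1 \<Longrightarrow> \<omega> k w = 0"
      and out: "\<And>t x. t > 0 \<Longrightarrow> x \<in> L0 \<Longrightarrow> shear u w t x \<in> D \<Longrightarrow> shear u w t x \<in> K1"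
      and red: "\<And>t. t > 0 \<Longrightarrow> M' \<subseteq> reduction D (shear u w t ` L0)"
      and lag: "Y.lagrangian M'" for w
  proof -
    obtain t where t: "t > 0" "gap_le e (shear u w t ` L0) L0"
      using shear_near[OF uS(1) w(1) L0S e] by blast
    let ?L = "shear u w t ` L0"
    have L: "lagrangian ?L"
      by (rule lagrangian_shear[OF uS(1) w L0])
    have "reduction D ?L = M'"
      using Y.lagrangian_eqI[OF lag lagrangian_reduction[OF reducing_D L] red[OF t(1)]] by simp
    moreover have "?L \<inter> D = K1"
    proof
      show "?L \<inter> D \<subseteq> K1"
        using out[OF t(1)] by blast
      show "K1 \<subseteq> ?L \<inter> D"
      proof
        fix k assume k: "k \<in> K1"
        then have "0 + k \<in> L0"
          using m(1) subspace_0 sK1(2) by (intro in_L0) auto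
        moreover have "shear u w t (0 + k) = k"
          using K1[OF k] k mem_K1 by (simp add: shear_def)
        ultimately show "k \<in> ?L \<inter> D"
          using k sK1(2) K(2) by (metis IntI image_eqI subsetD)
      qed
    qed
    ultimately show thesis
      using result[OF L] t(2) dim_K1 by (simp add: L0_def)
  qed
  from M' show thesis
  proof
    assume eq: "M' = M"
    show thesis
    proof (rule finish[of u])
      show "u \<in> S" "\<omega> u u = 0"
        using uS(1) by (simp_all add: form_self)
      show "\<omega> k u = 0" if "k \<in> K1" for k
        using that mem_K1 by blast
      show "Y.lagrangian M'"
        using eq M by simp
      fix t :: real assume t: "t > 0"
      show "shear u u t x \<in> K1" if x: "x \<in> L0" "shear u u t x \<in> D" for x
      proof -
        obtain y d' k where d: "y \<in> M" "d' \<in> D'" "k \<in> K" "x = y + k + d'" "d' \<in> perp K" "\<omega> x u = \<omega> k u"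
          using decompose[OF x(1)] by blast
        define s where "s = 2 * t * \<omega> k u"
        have g: "shear u u t x = y + k + (d' + s *\<^sub>R u)"
          using d(4,6) by (simp add: shear_def s_def scaleR_2[symmetric] algebra_simps)
        have "d' + s *\<^sub>R u \<in> D'"
          using d(2) u(1) D'(2) by (simp add: subspace_add subspace_scale)
        then have "y = 0" and z: "d' + s *\<^sub>R u = 0"
          using splitting_unique[of y k "d' + s *\<^sub>R u"] d m(2) K(2) x(2) g by auto
        \<comment> \<open>Pairing with \<open>k0\<close> isolates the coefficient of \<open>u\<close>.\<close>
        have "\<omega> k0 (d' + s *\<^sub>R u) = s * \<omega> k0 u"
          using perpD2[OF d(5) k0(1)] k0(1) KS d(2) D'(3) uS(1) subspace_S
          by (simp add: form_add_right form_scale_right subspace_scale subset_iff)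
        moreover have "\<omega> k0 (0::'a) = 0"
          using k0(1) KS by (auto simp: form_zero)
        ultimately have "s = 0"
          using z k0(2) by simp
        then have "\<omega> k u = 0"
          using t by (simp add: s_def)
        then show ?thesis
          using g z \<open>y = 0\<close> d(3) mem_K1 by simp
      qed
      show "M' \<subseteq> reduction D (shear u u t ` L0)"
      proof
        fix y assume "y \<in> M'"
        then have y: "y \<in> M"
          using eq by simp
        then have "y + 0 \<in> L0"
          using K(1) subspace_0 by (intro in_L0) auto
        moreover have "shear u u t (y + 0) = y + 0"
          using inL0_form[OF y, of 0] K(1) uS(1) by (simp add: shear_def subspace_0 form_zero)
        ultimately have "y + 0 \<in> shear u u t ` L0"
          by (metis image_eqI)
        then have "\<exists>d\<in>D. y + d \<in> shear u u t ` L0"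
          using D(2) subspace_0 by blast
        then show "y \<in> reduction D (shear u u t ` L0)"
          using y m(2) mem_reduction[OF reducing_D] lagrangian_shear[OF uS(1) uS(1) _ L0] uS(1)
          by (auto simp: form_self)
      qed
    qed
  next
    assume "\<exists>v\<in>Y. v \<notin> M \<and> M' = Y.absorb (span {v}) M"
    then obtain v where v: "v \<in> Y" "v \<notin> M" "M' = Y.absorb (span {v}) M"
      by blast
    have vS: "v \<in> S"
      using v(1) Y_subset by blast
    have vu: "\<omega> v u = 0"
      using perpD2[OF uS(2) v(1) vS] .
    have Dv: "\<omega> d v = 0" if "d \<in> D \<union> D'" for d
      using that v(1) D(4) D'(4) by (auto simp: perp_def)
    show thesis
    proof (rule finish[of v])
      show "v \<in> S" "\<omega> v u = 0"
        using vS vu .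
      show "\<omega> k v = 0" if "k \<in> K1" for k
        using that sK1(2) K(2) Dv by blast
      show "Y.lagrangian M'"
        using v(3) Y.lagrangian_absorb[OF M Y.isotropic_line[OF v(1)]] by simp
      fix t :: real assume t: "t > 0"
      show "shear u v t x \<in> K1" if x: "x \<in> L0" "shear u v t x \<in> D" for x
      proof -
        obtain y d' k where d: "y \<in> M" "d' \<in> D'" "k \<in> K" "x = y + k + d'" "\<omega> x u = \<omega> k u"
          using decompose[OF x(1)] by blast
        let ?y = "y + (t * \<omega> k u) *\<^sub>R v" and ?d = "d' + (t * \<omega> x v) *\<^sub>R u"
        have g: "shear u v t x = ?y + k + ?d"
          using d(4,5) by (simp add: shear_def algebra_simps)
        have "?d \<in> D'" "?y \<in> Y"
          using d(1,2) u(1) v(1) m(2) D'(2) subspace_Y by (auto simp: subspace_add subspace_scale)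
        then have y0: "?y = 0" and d0: "?d = 0"
          using splitting_unique[of ?y k ?d] d(3) K(2) x(2) g by auto
        have ku: "\<omega> k u = 0"
        proof (rule ccontr)
          assume "\<omega> k u \<noteq> 0"
          moreover define c where "c = t * \<omega> k u"
          ultimately have "c \<noteq> 0" "c *\<^sub>R v = - y"
            using t y0 by (simp_all add: eq_neg_iff_add_eq_0 add.commute)
          then have "v = inverse c *\<^sub>R (- y)"
            by (metis scaleR_left_imp_eq scaleR_scaleR right_inverse scaleR_one)
          moreover have "inverse c *\<^sub>R (- y) \<in> M"
            using d(1) m(1) by (intro subspace_scale subspace_neg)
          ultimately show False
            using v(2) by simp
        qed
        then have "y = 0"
          using y0 by simp
        then have "\<omega> x v = 0"
          using d Dv[of k] Dv[of d'] K(2) KS D'(3) vS by (auto simp: form_add_left subset_iff)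
        then show ?thesis
          using g ku \<open>y = 0\<close> d0 d(3) mem_K1 by simp
      qed
      show "M' \<subseteq> reduction D (shear u v t ` L0)"
      proof
        fix a assume "a \<in> M'"
        then obtain y b where y: "a = y + b" "y \<in> M" "y \<in> Y.perp (span {v})" "b \<in> span {v}"
          unfolding v(3) Y.absorb_def by (auto elim!: set_plus_elim)
        moreover from y(4) obtain c where "b = c *\<^sub>R v"
          by (auto simp: span_singleton)
        moreover have "\<omega> y v = 0"
          using Y.perpD[OF y(3)] span_base[of v "{v}"] by simp
        ultimately have a: "a = y + c *\<^sub>R v" "y \<in> M" "\<omega> y v = 0"
          by simp_all
        \<comment> \<open>This multiple of \<open>k0\<close> is sheared by exactly \<open>c\<close> times \<open>v\<close>.\<close>
        define k where "k = (c / (t * \<omega> k0 u)) *\<^sub>R k0"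
        have k: "k \<in> K" "t * \<omega> k u = c"
          using k0 K(1) KS uS(1) t by (auto simp: k_def subspace_scale form_scale_left)
        have "\<omega> (y + k) v = 0"
          using a(2,3) k(1) K(2) Dv[of k] m(2) Y_subset KS vS by (auto simp: form_add_left subset_iff)
        then have "shear u v t (y + k) = a + k"
          using inL0_form[OF a(2) k(1)] k(2) a(1) by (simp add: shear_def algebra_simps)
        then have "a + k \<in> shear u v t ` L0"
          using in_L0[OF a(2) k(1)] by (metis image_eqI)
        then have "\<exists>d\<in>D. a + d \<in> shear u v t ` L0"
          using k(1) K(2) by blast
        moreover have "a \<in> Y"
          using a(1,2) v(1) m(2) subspace_Y by (auto simp: subspace_add subspace_scale)
        ultimately show "a \<in> reduction D (shear u v t ` L0)"
          using mem_reduction[OF reducing_D lagrangian_shear[OF uS(1) vS vu L0]] by blast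
      qed
    qed
  qed
qed

end

text \<open>A coisotropic subspace \<open>C\<close> splits as \<open>Y \<oplus> C\<^sup>\<bottom>\<close>; in the symplectic space \<open>Y\<^sup>\<bottom>\<close> the subspace
  \<open>C\<^sup>\<bottom>\<close> is Lagrangian, so it has a Lagrangian complement there.\<close>

lemma (in symplectic_subspace) coisotropic_splitting_exists:
  assumes C: "subspace C" "C \<subseteq> S" "perp C \<subseteq> C"
  obtains Y D' where "coisotropic_splitting S \<omega> Y (perp C) D'" "Y + perp C = C"
proof -
  let ?D = "perp C"
  have sD: "subspace ?D" "?D \<subseteq> S" "perp ?D = C"
    using subspace_perp[OF C(2)] perp_subset perp_perp[OF C(1,2)] by auto
  obtain Y where Y: "subspace Y" "Y \<subseteq> C" "?D \<inter> Y = {0}" "?D + Y = C" "dim ?D + dim Y = dim C"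
    by (rule subspace_complement[OF sD(1) C(1,3)])
  have YS: "Y \<subseteq> S"
    using Y(2) C(2) by blast
  have DY: "?D \<subseteq> perp Y"
    using perp_antimono[OF Y(2)] .
  have "Y \<subseteq> perp ?D"
    using Y(2) sD(3) by simp
  then have "Y \<inter> perp Y \<subseteq> perp (?D + Y)"
    using perp_plus[OF sD(1) Y(1) sD(2) YS] by blast
  then have "Y \<inter> perp Y \<subseteq> {0}"
    using Y(3,4) by auto
  then have nd: "Y \<inter> perp Y = {0}"
    using Y(1) subspace_perp[OF YS] subspace_0 by blast
  interpret Y: symplectic_splitting S \<omega> Y
    by unfold_locales (use Y(1) YS nd in auto)
  have pp: "perp (perp Y) = Y" "subspace (perp Y)" "perp Y \<subseteq> S"
    using perp_perp[OF Y(1) YS] subspace_perp[OF YS] perp_subset by auto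
  interpret Z: symplectic_splitting S \<omega> "perp Y"
    by unfold_locales (use pp nd in auto)
  have "perp Y \<inter> perp ?D = perp (?D + Y)"
    using perp_plus[OF sD(1) Y(1) sD(2) YS] by blast
  then have "Z.Y.lagrangian ?D"
    using sD(1) Y(4) by (simp add: Z.Y.lagrangian_def Z.Y_perp)
  then obtain D' where D': "Z.Y.lagrangian D'" "?D \<inter> D' = {0}"
    by (rule Z.Y.lagrangian_complement_exists)
  have iD: "isotropic ?D"
    using sD C(3) by (simp add: isotropic_def)
  have "dim C + dim ?D = dim S" "dim (perp Y) + dim Y = dim S"
    using dim_perp[OF C(1,2)] dim_perp[OF Y(1) YS] by simp_all
  then have "Y.reducing ?D" "Y.reducing D'"
    using Y(5) iD DY Z.Y_lagrangian_isotropic[OF D'(1)] Z.Y.lagrangian_subset[OF D'(1)]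
      Z.Y.dim_lagrangian[OF D'(1)] by (simp_all add: Y.reducing_def)
  then have "coisotropic_splitting S \<omega> Y ?D D'"
    by unfold_locales (use D'(2) in auto)
  then show ?thesis
    using that Y(4) by (simp add: add.commute)
qed


section \<open>The Sabot topology in a linear chart\<close>

context symplectic_chart
begin

text \<open>
  All Lagrangians have the same dimension, so the inequality \<open>d(L, L') \<le> k - j\<close> between differences can
  be written with sums of natural numbers.
\<close>

lemma sublevel_image:
  assumes "lagrangian L"
  shows "sublevel V (\<phi> ` L, k) =
    {(\<phi> ` L', j) | L' j. lagrangian L' \<and> dim L + j \<le> dim (L \<inter> L') + k}"
proof -
  have codim: "int (lag_codim V (\<phi> ` L) (\<phi> ` L')) \<le> int k - int j \<longleftrightarrow> dim L + j \<le> dim (L \<inter> L') + k"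
    if "lagrangian L'" for L' and j :: nat
  proof -
    have "subspace L" "L \<subseteq> T" "subspace L'" "L' \<subseteq> T"
      using assms that lagrangian_subset by (simp_all add: lagrangian_def)
    then have "lag_codim V (\<phi> ` L) (\<phi> ` L') = dim L - dim (L \<inter> L')"
      unfolding lag_codim_def using chart_image_Int vdim_image[of L] vdim_image[of "L \<inter> L'"]
      by (simp add: subspace_inter inf.coboundedI1)
    moreover have "dim (L \<inter> L') \<le> dim L"
      by (rule dim_subset) simp
    ultimately show ?thesis
      by linarith
  qed
  then show ?thesis
    by (auto simp: sublevel_def indexed_lagrangians_def lagrangians_eq)
qed

lemma mem_sublevel:
  assumes "lagrangian L" "lagrangian L'"
  shows "(\<phi> ` L', j) \<in> sublevel V (\<phi> ` L, k) \<longleftrightarrow> dim L + j \<le> dim (L \<inter> L') + k"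
proof -
  have "\<phi> ` L' = \<phi> ` L'' \<longleftrightarrow> L' = L''" if "lagrangian L''" for L''
    by (rule chart_image_eq[OF lagrangian_subset[OF assms(2)] lagrangian_subset[OF that]])
  then show ?thesis
    unfolding sublevel_image[OF assms(1)] using assms(2) by auto
qed

lemma sublevel_refl: "M \<in> lagrangians V \<Longrightarrow> (M, k) \<in> sublevel V (M, k)"
  using mem_sublevel by (auto simp: lagrangians_eq)

text \<open>
  This is the triangle inequality for the distance: inside \<open>L'\<close> the codimension of
  \<open>L \<inter> L' \<inter> L''\<close> is at most the sum of the codimensions of \<open>L \<inter> L'\<close> and \<open>L' \<inter> L''\<close>.
\<close>

lemma sublevel_trans:
  assumes "M \<in> lagrangians V" "q \<in> sublevel V (M, k)"
  shows "sublevel V q \<subseteq> sublevel V (M, k)"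
proof
  obtain L where L: "lagrangian L" "M = \<phi> ` L"
    using assms(1) lagrangians_eq by blast
  fix p assume p: "p \<in> sublevel V q"
  obtain L' j where L': "q = (\<phi> ` L', j)" "lagrangian L'" "dim L + j \<le> dim (L \<inter> L') + k"
    using assms(2) sublevel_image[OF L(1)] L(2) by auto
  obtain L'' i where L'': "p = (\<phi> ` L'', i)" "lagrangian L''" "dim L' + i \<le> dim (L' \<inter> L'') + j"
    using p sublevel_image[OF L'(2)] L'(1) by auto
  have sub: "subspace (L \<inter> L')" "subspace (L' \<inter> L'')" "subspace L'"
    using L(1) L'(2) L''(2) by (simp_all add: lagrangian_def subspace_inter)
  have "dim (L \<inter> L' + L' \<inter> L'') \<le> dim L'"
    by (rule dim_subset[OF plus_subspace_subset[OF inf_le2 inf_le1 sub(3)]])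
  moreover have "dim (L \<inter> L' \<inter> (L' \<inter> L'')) \<le> dim (L \<inter> L'')"
    by (rule dim_subset) blast
  ultimately have "dim (L \<inter> L') + dim (L' \<inter> L'') \<le> dim L' + dim (L \<inter> L'')"
    using dim_plus_Int[OF sub(1,2)] by linarith
  then have "dim L + i \<le> dim (L \<inter> L'') + k"
    using L'(3) L''(3) by linarith
  then show "p \<in> sublevel V (M, k)"
    using mem_sublevel[OF L(1) L''(2)] L(2) L''(1) by simp
qed

lemma openin_lagrangians: "openin (lagrangian_topology V) (lagrangians V)"
  unfolding openin_lagrangian_topology using lagrangians_image lagrangian_subset
  by (blast intro: zero_less_one)

lemma topspace_lagrangian_topology: "topspace (lagrangian_topology V) = lagrangians V"
  using openin_subset[OF openin_lagrangians] openin_topspace[of "lagrangian_topology V"]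
  unfolding openin_lagrangian_topology by (intro antisym) simp_all

text \<open>
  The open sets are the sets with open levels that are closed under passing to sublevels. For a basic
  set the openness of its levels is the stability of the distance of Lagrangians under perturbation;
  conversely, such a set is the union of the basic sets generated by its levels.
\<close>

theorem openin_sabot_topology:
  "openin (sabot_topology V) W \<longleftrightarrow> W \<subseteq> indexed_lagrangians V \<and>
     (\<forall>k. openin (lagrangian_topology V) {M. (M, k) \<in> W}) \<and> (\<forall>p\<in>W. sublevel V p \<subseteq> W)"
proof -
  define sab where "sab W \<longleftrightarrow> W \<subseteq> indexed_lagrangians V \<and>
     (\<forall>k. openin (lagrangian_topology V) {M. (M, k) \<in> W}) \<and> (\<forall>p\<in>W. sublevel V p \<subseteq> W)" for W
  have "istopology sab"
    unfolding istopology_def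
  proof (intro conjI allI impI)
    fix A B assume AB: "sab A" "sab B"
    have "{M. (M, k) \<in> A \<inter> B} = {M. (M, k) \<in> A} \<inter> {M. (M, k) \<in> B}" for k
      by blast
    then show "sab (A \<inter> B)"
      using AB unfolding sab_def by (metis IntE Int_greatest inf.coboundedI1 openin_Int)
  next
    fix \<A> assume \<A>: "\<forall>A\<in>\<A>. sab A"
    have level: "{M. (M, k) \<in> \<Union>\<A>} = \<Union>((\<lambda>A. {M. (M, k) \<in> A}) ` \<A>)" for k
      by blast
    show "sab (\<Union>\<A>)"
      unfolding sab_def
    proof (intro conjI allI ballI)
      show "\<Union>\<A> \<subseteq> indexed_lagrangians V"
        using \<A> by (auto simp: sab_def)
      show "openin (lagrangian_topology V) {M. (M, k) \<in> \<Union>\<A>}" for k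
        unfolding level using \<A> by (intro openin_Union) (auto simp: sab_def)
      show "sublevel V p \<subseteq> \<Union>\<A>" if "p \<in> \<Union>\<A>" for p
        using that \<A> unfolding sab_def by blast
    qed
  qed
  then have sab: "openin (topology sab) = sab"
    by (rule topology_inverse')
  have "sabot_topology V = topology sab"
    unfolding sabot_topology_def
  proof (rule topology_base_unique, unfold sab)
    fix B assume "B \<in> sabot_base V"
    then obtain U k where B: "B = (\<Union>p\<in>U \<times> {k}. sublevel V p)" and U: "openin (lagrangian_topology V) U"
      by (auto simp: sabot_base_def)
    have Ulag: "U \<subseteq> lagrangians V"
      using openin_subset[OF U] topspace_lagrangian_topology by simp
    show "sab B"
      unfolding sab_def
    proof (intro conjI allI ballI)
      show "B \<subseteq> indexed_lagrangians V"
        by (auto simp: B sublevel_def)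
      show "sublevel V q \<subseteq> B" if "q \<in> B" for q
        using that sublevel_trans Ulag unfolding B by blast
      fix j
      show "openin (lagrangian_topology V) {M. (M, j) \<in> B}"
        unfolding openin_lagrangian_topology
      proof (intro conjI allI impI)
        show "{M. (M, j) \<in> B} \<subseteq> lagrangians V"
          by (auto simp: B sublevel_def indexed_lagrangians_def)
        fix L' assume L': "lagrangian L' \<and> \<phi> ` L' \<in> {M. (M, j) \<in> B}"
        then obtain M where M: "M \<in> U" "(\<phi> ` L', j) \<in> sublevel V (M, k)"
          by (auto simp: B)
        then obtain L where L: "lagrangian L" "M = \<phi> ` L"
          using Ulag lagrangians_eq by blast
        obtain e where e: "e > 0" "\<And>L1. lagrangian L1 \<Longrightarrow> gap_le e L1 L \<Longrightarrow> \<phi> ` L1 \<in> U"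
          using U L M(1) unfolding openin_lagrangian_topology by blast
        have dist: "dim L + j \<le> dim (L \<inter> L') + k"
          using M(2) L L' mem_sublevel by simp
        obtain d where d: "d > 0" "\<And>L''. lagrangian L'' \<Longrightarrow> gap_le d L'' L' \<Longrightarrow>
            \<exists>L1. lagrangian L1 \<and> gap_le e L1 L \<and> dim L1 + dim (L \<inter> L') \<le> dim (L1 \<inter> L'') + dim L"
          using lagrangian_distance_stable[OF L(1) _ e(1)] L' by blast
        have "(\<phi> ` L'', j) \<in> B" if L'': "lagrangian L''" "gap_le d L'' L'" for L''
        proof -
          obtain L1 where L1: "lagrangian L1" "gap_le e L1 L"
              "dim L1 + dim (L \<inter> L') \<le> dim (L1 \<inter> L'') + dim L"
            using d(2)[OF L''] by blast
          then have "dim L1 + j \<le> dim (L1 \<inter> L'') + k"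
            using dist by linarith
          then have "(\<phi> ` L'', j) \<in> sublevel V (\<phi> ` L1, k)"
            using mem_sublevel L1(1) L''(1) by blast
          then show ?thesis
            using e(2)[OF L1(1,2)] by (auto simp: B)
        qed
        then show "\<exists>d>0. \<forall>L''. lagrangian L'' \<and> gap_le d L'' L' \<longrightarrow> \<phi> ` L'' \<in> {M. (M, j) \<in> B}"
          using d(1) by blast
      qed
    qed
  next
    fix W p assume W: "sab W" and p: "p \<in> W"
    obtain M k where Mk: "p = (M, k)"
      by (cases p)
    define B where "B = (\<Union>p\<in>{M. (M, k) \<in> W} \<times> {k}. sublevel V p)"
    have "B \<in> sabot_base V"
      using W unfolding sabot_base_def sab_def B_def by blast
    moreover have "M \<in> lagrangians V"
      using W p Mk by (auto simp: sab_def indexed_lagrangians_def)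
    then have "p \<in> B"
      using p Mk sublevel_refl by (auto simp: B_def)
    moreover have "B \<subseteq> W"
      using W unfolding sab_def B_def by blast
    ultimately show "\<exists>B. B \<in> sabot_base V \<and> p \<in> B \<and> B \<subseteq> W"
      by blast
  qed
  then show ?thesis
    using sab by (simp add: sab_def)
qed

lemma topspace_sabot_topology: "topspace (sabot_topology V) = indexed_lagrangians V"
proof -
  have "{M. (M, k) \<in> indexed_lagrangians V} = lagrangians V" for k
    by (simp add: indexed_lagrangians_def)
  moreover have "sublevel V p \<subseteq> indexed_lagrangians V" for p
    by (auto simp: sublevel_def)
  ultimately have "openin (sabot_topology V) (indexed_lagrangians V)"
    using openin_sabot_topology[of "indexed_lagrangians V"] openin_lagrangians by simp
  from openin_subset[OF this] show ?thesis
    using openin_topspace[of "sabot_topology V"] unfolding openin_sabot_topology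
    by (intro antisym) simp_all
qed

lemma openin_indexed_lagrangians_le: "openin (sabot_topology V) (indexed_lagrangians_le V r)"
proof -
  have "{M. (M, k) \<in> indexed_lagrangians_le V r} = (if k \<le> r then lagrangians V else {})" for k
    by (auto simp: indexed_lagrangians_le_def)
  moreover have "sublevel V p \<subseteq> indexed_lagrangians_le V r" if "p \<in> indexed_lagrangians_le V r" for p
    using that by (auto simp: sublevel_def indexed_lagrangians_le_def indexed_lagrangians_def)
  ultimately show ?thesis
    unfolding openin_sabot_topology using openin_lagrangians
    by (auto simp: indexed_lagrangians_le_def indexed_lagrangians_def)
qed

text \<open>
  Every element of a sublevel is reached by steps that lower the index by one and either keep the
  Lagrangian or replace \<open>M\<close> by \<open>(M \<inter> v\<^sup>\<bottom>) + \<real> v\<close>. Choosing \<open>v\<close> in \<open>M' - M\<close> makes the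
  intersection with the target \<open>M'\<close> grow.
\<close>

lemma sublevel_induct:
  assumes step: "\<And>M M' k. lagrangian M \<Longrightarrow> P M (Suc k) \<Longrightarrow>
      M' = M \<or> (\<exists>v\<in>T. v \<notin> M \<and> M' = absorb (span {v}) M) \<Longrightarrow> P M' k"
    and "lagrangian M" "P M k" "lagrangian M'" "dim M + j \<le> dim (M \<inter> M') + k"
  shows "P M' j"
  using assms(2-5)
proof (induction "k - j" arbitrary: M k)
  case 0
  have "dim (M \<inter> M') \<le> dim M"
    by (rule dim_subset) simp
  then have "k = j" "dim (M \<inter> M') = dim M"
    using 0 by linarith+
  moreover from this have "M \<inter> M' = M"
    using 0 by (intro subspace_dim_equal) (auto simp: lagrangian_def subspace_inter)
  ultimately show ?case
    using lagrangian_eqI[of M M'] 0 by auto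
next
  case (Suc s)
  then obtain i where i: "k = Suc i" "s = i - j" "j \<le> i"
    by (cases k) auto
  show ?case
  proof (cases "M = M'")
    case True
    then show ?thesis
      using Suc.hyps(1)[OF i(2), of M] step[of M i M] Suc.prems i by simp
  next
    case False
    then obtain v where v: "v \<in> M'" "v \<notin> M"
      using lagrangian_eqI Suc.prems by blast
    have sM: "subspace M" "subspace M'" "M' \<subseteq> T" "perp M' = M'"
      using Suc.prems lagrangian_subset by (simp_all add: lagrangian_def)
    have vT: "v \<in> T"
      using v(1) sM(3) by blast
    let ?M = "absorb (span {v}) M"
    have spT: "span {v} \<subseteq> T"
      using vT subspace_S by (intro span_minimal) auto
    have lag: "lagrangian ?M"
      by (rule lagrangian_absorb[OF Suc.prems(1) isotropic_line[OF vT]])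
    have sub: "subspace (M \<inter> perp (span {v}))"
      using sM(1) subspace_perp[OF spT] by (rule subspace_inter)
    have "span {v} \<subseteq> M'"
      using v(1) sM(2) by (intro span_minimal) auto
    then have "M' \<subseteq> perp (span {v})"
      using perp_antimono[of "span {v}" M'] sM(4) by simp
    then have "M \<inter> M' \<subseteq> ?M \<inter> M'" "v \<in> ?M \<inter> M'"
      using subset_plus[OF sub subspace_span[of "{v}"]] span_base[of v "{v}"] v(1)
      by (auto simp: absorb_def)
    moreover have "subspace (M \<inter> M')" "subspace (?M \<inter> M')"
      using sM(1,2) lag by (simp_all add: lagrangian_def subspace_inter)
    ultimately have "dim (M \<inter> M') < dim (?M \<inter> M')"
      using subspace_dim_equal[of "M \<inter> M'" "?M \<inter> M'"] v(2) by (metis IntD1 not_le)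
    then have "dim ?M + j \<le> dim (?M \<inter> M') + i"
      using Suc.prems(4) dim_lagrangian[OF lag] dim_lagrangian[OF Suc.prems(1)] i(1) by linarith
    moreover have "P ?M i"
      using step[of M i ?M] Suc.prems(1,2) v(2) vT i(1) by blast
    ultimately show ?thesis
      using Suc.hyps(1)[OF i(2) lag] Suc.prems(3) by blast
  qed
qed

end


section \<open>Reduction as a quotient map\<close>

context coisotropic_splitting
begin

lemma section_continuous:
  assumes M: "Y.lagrangian M" and N: "reducing N" and e: "e > 0"
  obtains d where "d > 0" "\<And>M'. gap_le d M' M \<Longrightarrow> gap_le e (M' + N) (M + N)"
proof -
  have "subspace M" "M \<subseteq> Y"
    using M Y.lagrangian_subset by (simp_all add: Y.lagrangian_def)
  moreover from this have "M \<inter> N = {0}"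
    using reducing_perp(2)[OF N] reducingD(2)[OF N] subspace_0 by blast
  ultimately show ?thesis
    using gap_le_plus[OF _ reducingD(2)[OF N] _ e] that by blast
qed

text \<open>
  If \<open>W\<close> is open, upper semicontinuity of the reduction shows that its preimage is open. Conversely, the
  continuous sections show that an open preimage forces open levels, and the lowering of the excess
  propagates membership in \<open>W\<close> down to all sublevels.
\<close>

theorem quotient_map_reduction:
  assumes X: "symplectic_chart S \<omega> X \<psi>" and V: "symplectic_chart Y \<omega> V \<phi>"
    and f: "\<And>L. lagrangian L \<Longrightarrow> f (\<psi> ` L) = (\<phi> ` reduction D L, dim (L \<inter> D))"
  shows "quotient_map (lagrangian_topology X)
    (subtopology (sabot_topology V) (indexed_lagrangians_le V (dim D))) f"
proof -
  interpret X: symplectic_chart S \<omega> X \<psi>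
    by (rule X)
  interpret V: symplectic_chart Y \<omega> V \<phi>
    by (rule V)
  let ?r = "indexed_lagrangians_le V (dim D)"
  have le_r: "f M \<in> ?r" if "M \<in> lagrangians X" for M
  proof -
    obtain L where L: "lagrangian L" "M = \<psi> ` L"
      using \<open>M \<in> lagrangians X\<close> X.lagrangians_eq by blast
    have "\<phi> ` reduction D L \<in> lagrangians V"
      using lagrangian_reduction[OF reducing_D L(1)] V.lagrangians_eq by blast
    moreover have "dim (L \<inter> D) \<le> dim D"
      by (rule dim_subset) simp
    ultimately show ?thesis
      using L f by (simp add: indexed_lagrangians_le_def)
  qed
  have lift: "lagrangian (M + absorb K D') \<and> f (\<psi> ` (M + absorb K D')) = (\<phi> ` M, dim K)"
    if "Y.lagrangian M" "subspace K" "K \<subseteq> D" for M K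
    using section_lagrangian section_reduction section_Int_D reducing_mixed that f by simp
  have subspace_K: "\<exists>K. subspace K \<and> K \<subseteq> D \<and> dim K = k" if "k \<le> dim D" for k
    using choose_subspace_of_subspace[OF that] D(2) by (metis span_eq_iff)
  have top: "topspace (subtopology (sabot_topology V) ?r) = ?r"
    unfolding topspace_subtopology V.topspace_sabot_topology
    by (auto simp: indexed_lagrangians_le_def indexed_lagrangians_def)
  show ?thesis
    unfolding quotient_map_def top X.topspace_lagrangian_topology
  proof (intro conjI allI impI)
    show "f ` lagrangians X = ?r"
    proof
      show "f ` lagrangians X \<subseteq> ?r"
        using le_r by blast
      show "?r \<subseteq> f ` lagrangians X"
      proof
        fix p assume "p \<in> ?r"
        then obtain M k where p: "p = (\<phi> ` M, k)" "Y.lagrangian M" "k \<le> dim D"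
          using V.lagrangians_eq by (auto simp: indexed_lagrangians_le_def)
        obtain K where "subspace K" "K \<subseteq> D" "dim K = k"
          using subspace_K[OF p(3)] by blast
        then have "lagrangian (M + absorb K D')" "f (\<psi> ` (M + absorb K D')) = p"
          using lift p by auto
        then show "p \<in> f ` lagrangians X"
          using X.lagrangians_eq by (metis imageI mem_Collect_eq)
      qed
    qed
  next
    fix W assume W: "W \<subseteq> ?r"
    let ?F = "{M \<in> lagrangians X. f M \<in> W}"
    have "openin (subtopology (sabot_topology V) ?r) W \<longleftrightarrow> openin (sabot_topology V) W"
      using openin_open_subtopology[OF V.openin_indexed_lagrangians_le] W by blast
    moreover have "openin (lagrangian_topology X) ?F \<longleftrightarrow> openin (sabot_topology V) W"
    proof
      assume "openin (sabot_topology V) W"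
      then have lev: "\<And>k. openin (lagrangian_topology V) {M. (M, k) \<in> W}"
        and down: "\<And>p. p \<in> W \<Longrightarrow> sublevel V p \<subseteq> W"
        unfolding V.openin_sabot_topology by auto
      show "openin (lagrangian_topology X) ?F"
        unfolding X.openin_lagrangian_topology
      proof (intro conjI allI impI)
        fix L assume "lagrangian L \<and> \<psi> ` L \<in> ?F"
        then have L: "lagrangian L" "(\<phi> ` reduction D L, dim (L \<inter> D)) \<in> W"
          using f by auto
        then obtain e where e: "e > 0"
          "\<And>M. Y.lagrangian M \<Longrightarrow> gap_le e M (reduction D L) \<Longrightarrow> (\<phi> ` M, dim (L \<inter> D)) \<in> W"
          using lev[of "dim (L \<inter> D)"] lagrangian_reduction[OF reducing_D L(1)]
          unfolding V.openin_lagrangian_topology by blast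
        obtain d where d: "d > 0" "\<And>L'. lagrangian L' \<Longrightarrow> gap_le d L' L \<Longrightarrow>
            dim (L' \<inter> D) \<le> dim (L \<inter> D) \<and>
            (\<exists>M. Y.lagrangian M \<and> gap_le e M (reduction D L) \<and>
              dim M + dim (L' \<inter> D) \<le> dim (M \<inter> reduction D L') + dim (L \<inter> D))"
          using reduction_upper_semicontinuous[OF L(1) e(1)] by blast
        have "f (\<psi> ` L') \<in> W" if L': "lagrangian L'" "gap_le d L' L" for L'
        proof -
          obtain M where M: "Y.lagrangian M" "gap_le e M (reduction D L)"
            "dim M + dim (L' \<inter> D) \<le> dim (M \<inter> reduction D L') + dim (L \<inter> D)"
            using d(2)[OF L'] by blast
          have "f (\<psi> ` L') \<in> sublevel V (\<phi> ` M, dim (L \<inter> D))"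
            using M(3) V.mem_sublevel[OF M(1) lagrangian_reduction[OF reducing_D L'(1)]] f[OF L'(1)]
            by simp
          then show ?thesis
            using down[OF e(2)[OF M(1,2)]] by blast
        qed
        then show "\<exists>d>0. \<forall>L'. lagrangian L' \<and> gap_le d L' L \<longrightarrow> \<psi> ` L' \<in> ?F"
          using d(1) X.lagrangians_eq by blast
      qed auto
    next
      assume F: "openin (lagrangian_topology X) ?F"
      have near: "\<exists>e>0. \<forall>L'. lagrangian L' \<and> gap_le e L' L \<longrightarrow> f (\<psi> ` L') \<in> W"
        if "lagrangian L" "f (\<psi> ` L) \<in> W" for L
      proof -
        have "\<psi> ` L \<in> ?F"
          using that X.lagrangians_eq by blast
        then have "\<exists>e>0. \<forall>L'. lagrangian L' \<and> gap_le e L' L \<longrightarrow> \<psi> ` L' \<in> ?F"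
          using F that(1) unfolding X.openin_lagrangian_topology by blast
        then show ?thesis
          by blast
      qed
      have le: "k \<le> dim D" if "(M, k) \<in> W" for M k
        using that W by (auto simp: indexed_lagrangians_le_def)
      show "openin (sabot_topology V) W"
        unfolding V.openin_sabot_topology
      proof (intro conjI allI ballI)
        show Wind: "W \<subseteq> indexed_lagrangians V"
          using W by (auto simp: indexed_lagrangians_le_def indexed_lagrangians_def)
        show "openin (lagrangian_topology V) {M. (M, k) \<in> W}" for k
          unfolding V.openin_lagrangian_topology
        proof (intro conjI allI impI)
          show "{M. (M, k) \<in> W} \<subseteq> lagrangians V"
            using Wind by (auto simp: indexed_lagrangians_def)
          fix M assume "Y.lagrangian M \<and> \<phi> ` M \<in> {M. (M, k) \<in> W}"
          then have M: "Y.lagrangian M" "(\<phi> ` M, k) \<in> W"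
            by auto
          obtain K where K: "subspace K" "K \<subseteq> D" "dim K = k"
            using subspace_K le[OF M(2)] by blast
          let ?N = "absorb K D'"
          obtain e where e: "e > 0" "\<And>L'. lagrangian L' \<Longrightarrow> gap_le e L' (M + ?N) \<Longrightarrow> f (\<psi> ` L') \<in> W"
            using near[of "M + ?N"] lift[OF M(1) K(1,2)] M(2) K(3) by auto
          obtain d where d: "d > 0" "\<And>M'. gap_le d M' M \<Longrightarrow> gap_le e (M' + ?N) (M + ?N)"
            using section_continuous[OF M(1) reducing_mixed[OF K(1,2)] e(1)] by blast
          have "(\<phi> ` M', k) \<in> W" if "Y.lagrangian M'" "gap_le d M' M" for M'
            using e(2)[OF _ d(2)[OF that(2)]] lift[OF that(1) K(1,2)] K(3) by simp
          then show "\<exists>d>0. \<forall>M'. Y.lagrangian M' \<and> gap_le d M' M \<longrightarrow> \<phi> ` M' \<in> {M. (M, k) \<in> W}"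
            using d(1) by blast
        qed
        fix p assume p: "p \<in> W"
        then obtain M k where M: "p = (\<phi> ` M, k)" "Y.lagrangian M"
          using Wind V.lagrangians_eq by (auto simp: indexed_lagrangians_def)
        have step: "(\<phi> ` M', j) \<in> W"
          if M: "Y.lagrangian M" "(\<phi> ` M, Suc j) \<in> W"
            and M': "M' = M \<or> (\<exists>v\<in>Y. v \<notin> M \<and> M' = Y.absorb (span {v}) M)" for M M' j
        proof -
          obtain K where K: "subspace K" "K \<subseteq> D" "dim K = Suc j"
            using subspace_K le[OF M(2)] by blast
          let ?L = "M + absorb K D'"
          obtain e where e: "e > 0" "\<And>L'. lagrangian L' \<Longrightarrow> gap_le e L' ?L \<Longrightarrow> f (\<psi> ` L') \<in> W"
            using near[of ?L] lift[OF M(1) K(1,2)] M(2) K(3) by auto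
          obtain L' where "lagrangian L'" "gap_le e L' ?L" "reduction D L' = M'" "dim (L' \<inter> D) = j"
            by (rule excess_lowering[OF M(1) K M' e(1)])
          then show ?thesis
            using e(2)[of L'] f by simp
        qed
        show "sublevel V p \<subseteq> W"
        proof
          fix q assume "q \<in> sublevel V p"
          then obtain M' j where q: "q = (\<phi> ` M', j)" "Y.lagrangian M'" "dim M + j \<le> dim (M \<inter> M') + k"
            using V.sublevel_image[OF M(2)] M(1) by auto
          have "(\<phi> ` M', j) \<in> W"
            by (rule V.sublevel_induct[of "\<lambda>M k. (\<phi> ` M, k) \<in> W", OF step M(2) _ q(2,3)])
               (use p M(1) in auto)
          then show "q \<in> W"
            using q(1) by simp
        qed
      qed
    qed
    ultimately show "openin (lagrangian_topology X) ?F \<longleftrightarrow>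
        openin (subtopology (sabot_topology V) ?r) W"
      by simp
  qed
qed

end

lemma (in symplectic_subspace) symplectic_chart_identity:
  "symplectic_chart S \<omega> (subspace_with_form S \<omega>) (\<lambda>x. x)"
  by unfold_locales (simp_all add: subspace_with_form_def bij_betw_def)

context coisotropic_splitting
begin

definition coset :: "'a \<Rightarrow> 'a set" where
  "coset x = {x + d | d. d \<in> D}"

lemma vcoset_eq: "vcoset (subspace_with_form S \<omega>) D = coset"
  by (rule ext) (simp add: vcoset_def coset_def subspace_with_form_def)

lemma mem_coset: "a \<in> coset x \<longleftrightarrow> a - x \<in> D"
  unfolding coset_def by (auto intro: exI[of _ "a - x"])

lemma coset_eq_iff: "coset x = coset y \<longleftrightarrow> x - y \<in> D"
proof
  assume "coset x = coset y"
  then show "x - y \<in> D"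
    using mem_coset[of x x] mem_coset[of x y] D(2) by (simp add: subspace_0)
next
  assume xy: "x - y \<in> D"
  have "a - x \<in> D \<longleftrightarrow> a - y \<in> D" for a
    using subspace_add[OF D(2) xy, of "a - x"] subspace_diff[OF D(2) _ xy, of "a - y"] by auto
  then show "coset x = coset y"
    using mem_coset by blast
qed

text \<open>
  Every coset of \<open>D\<close> in \<open>C = Y \<oplus> D\<close> contains exactly one element of \<open>Y\<close>, and \<open>\<omega>\<close> does not change when
  elements of \<open>D\<close> are added, because \<open>D\<close> is orthogonal to \<open>C\<close>.
\<close>

lemma symplectic_chart_reduced_space:
  assumes C: "C = Y + D" and orth: "vorth (subspace_with_form S \<omega>) C = D"
  shows "symplectic_chart Y \<omega> (reduced_space (subspace_with_form S \<omega>) C) coset"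
proof -
  let ?X = "subspace_with_form S \<omega>"
  have ops: "vadd ?X = (+)" "vscale ?X = (*\<^sub>R)" "vform ?X = \<omega>"
    by (simp_all add: subspace_with_form_def)
  have YD: "Y \<inter> D = {0}"
    using reducing_perp(2)[OF reducing_D] .
  have YS: "y \<in> Y \<Longrightarrow> y \<in> S" and DS: "d \<in> D \<Longrightarrow> d \<in> S" for y d
    using Y_subset D(3) by auto
  show ?thesis
  proof
    show "bij_betw coset Y (vcarrier (reduced_space ?X C))"
      unfolding bij_betw_def
    proof
      show "inj_on coset Y"
      proof (rule inj_onI)
        fix x y assume "x \<in> Y" "y \<in> Y" "coset x = coset y"
        then have "x - y \<in> Y \<inter> D"
          using coset_eq_iff subspace_Y by (simp add: subspace_diff)
        then show "x = y"
          using YD by simp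
      qed
      have "coset ` Y = coset ` C"
      proof
        show "coset ` Y \<subseteq> coset ` C"
          using subset_plus(1)[OF subspace_Y D(2)] C by blast
        show "coset ` C \<subseteq> coset ` Y"
        proof
          fix A assume "A \<in> coset ` C"
          then have "A \<in> coset ` (Y + D)"
            by (simp add: C)
          then obtain y d where A: "A = coset (y + d)" "y \<in> Y" "d \<in> D"
            by (auto elim!: set_plus_elim)
          then have "coset (y + d) = coset y"
            using coset_eq_iff by simp
          then show "A \<in> coset ` Y"
            using A by blast
        qed
      qed
      then show "coset ` Y = vcarrier (reduced_space ?X C)"
        by (simp add: reduced_space_def vcoset_eq orth)
    qed
    show "coset 0 = vzero (reduced_space ?X C)"
      by (simp add: reduced_space_def orth coset_def)
    show "coset (x + y) = vadd (reduced_space ?X C) (coset x) (coset y)" if "x \<in> Y" "y \<in> Y" for x y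
    proof -
      have "coset (x + y) \<subseteq> {a + b |a b. a \<in> coset x \<and> b \<in> coset y}"
      proof
        fix a assume "a \<in> coset (x + y)"
        then have "a - y \<in> coset x" "y \<in> coset y" "a = (a - y) + y"
          using D(2) by (simp_all add: mem_coset subspace_0 algebra_simps)
        then show "a \<in> {a + b |a b. a \<in> coset x \<and> b \<in> coset y}"
          by blast
      qed
      moreover have "a + b \<in> coset (x + y)" if "a \<in> coset x" "b \<in> coset y" for a b
        using subspace_add[OF D(2), of "a - x" "b - y"] that by (simp add: mem_coset algebra_simps)
      ultimately show ?thesis
        by (auto simp: reduced_space_def ops)
    qed
    show "coset (c *\<^sub>R x) = vscale (reduced_space ?X C) c (coset x)" if "x \<in> Y" for c x
    proof -
      have "coset (c *\<^sub>R x) \<subseteq> {c *\<^sub>R a + d |a d. a \<in> coset x \<and> d \<in> D}"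
      proof
        fix a assume "a \<in> coset (c *\<^sub>R x)"
        then have "x \<in> coset x" "a - c *\<^sub>R x \<in> D" "a = c *\<^sub>R x + (a - c *\<^sub>R x)"
          using D(2) by (simp_all add: mem_coset subspace_0)
        then show "a \<in> {c *\<^sub>R a + d |a d. a \<in> coset x \<and> d \<in> D}"
          by blast
      qed
      moreover have "c *\<^sub>R a + d \<in> coset (c *\<^sub>R x)" if "a \<in> coset x" "d \<in> D" for a d
        using subspace_add[OF D(2) subspace_scale[OF D(2), of "a - x" c], of d] that
        by (simp add: mem_coset algebra_simps)
      ultimately show ?thesis
        by (auto simp: reduced_space_def ops orth)
    qed
    show "vform (reduced_space ?X C) (coset x) (coset y) = \<omega> x y" if xy: "x \<in> Y" "y \<in> Y" for x y
    proof -
      have "\<omega> (x + d) (y + d') = \<omega> x y" if d: "d \<in> D" "d' \<in> D" for d d'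
      proof -
        have "\<omega> d y = 0" "\<omega> d d' = 0" "\<omega> x d' = 0"
          using D(1,4) d xy perpD[of d Y y] perpD[of d D d'] perpD2[of d' Y x] YS
          by (auto simp: isotropic_def)
        then show ?thesis
          using YS DS d xy subspace_S by (simp add: form_add_left form_add_right subspace_add)
      qed
      then have const: "\<forall>a\<in>coset x. \<forall>b\<in>coset y. \<omega> a b = \<omega> x y"
        by (auto simp: coset_def)
      have "x \<in> coset x" "y \<in> coset y"
        using D(2) by (simp_all add: mem_coset subspace_0)
      then have "t = \<omega> x y" if "\<forall>a\<in>coset x. \<forall>b\<in>coset y. \<omega> a b = t" for t
        using that[rule_format, of x y] by simp
      then have "(THE t. \<forall>a\<in>coset x. \<forall>b\<in>coset y. \<omega> a b = t) = \<omega> x y"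
        using const by (rule the_equality[rotated])
      then show ?thesis
        by (simp add: reduced_space_def ops)
    qed
  qed
qed

lemma lag_reduction_eq:
  assumes C: "C = Y + D" and orth: "vorth (subspace_with_form S \<omega>) C = D" and L: "lagrangian L"
  shows "lag_reduction (subspace_with_form S \<omega>) C L = coset ` reduction D L"
  unfolding lag_reduction_def orth vcoset_eq
proof
    show "coset ` (L \<inter> C) \<subseteq> coset ` reduction D L"
    proof
      fix A assume "A \<in> coset ` (L \<inter> C)"
      then obtain x where x: "x \<in> L" "x \<in> C" "A = coset x"
        by blast
      obtain y d where y: "x = y + d" "y \<in> Y" "d \<in> D"
        using x(2) C by (metis set_plus_elim)
      then have "y \<in> reduction D L" "coset x = coset y"
        using x(1) mem_reduction[OF reducing_D L] coset_eq_iff by auto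
      then show "A \<in> coset ` reduction D L"
        using x(3) by blast
    qed
    show "coset ` reduction D L \<subseteq> coset ` (L \<inter> C)"
    proof
      fix A assume "A \<in> coset ` reduction D L"
      then obtain y d where y: "A = coset y" "y \<in> Y" "d \<in> D" "y + d \<in> L"
        using mem_reduction[OF reducing_D L] by blast
      then have "y + d \<in> L \<inter> C" "coset (y + d) = coset y"
        using C coset_eq_iff by auto
      then show "A \<in> coset ` (L \<inter> C)"
        using y(1) by (metis image_eqI)
    qed
qed

end

theorem theorem9p1:
  fixes S :: "'a::euclidean_space set"
    and \<omega> :: "'a \<Rightarrow> 'a \<Rightarrow> real"
    and X :: "'a form_space"
    and C :: "'a set"
    and r :: nat
  assumes "subspace S"
    and "symplectic_form_on S \<omega>"
    and "X = subspace_with_form S \<omega>"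
    and "coisotropic X C"
    and "r = vdim X (vorth X C)"
  shows "quotient_map (lagrangian_topology X)
           (subtopology (sabot_topology (reduced_space X C))
             (indexed_lagrangians_le (reduced_space X C) r))
           (indexed_reduction X C)"
proof -
  interpret symplectic_subspace S \<omega>
    using assms(1,2) by unfold_locales
  have chart: "symplectic_chart S \<omega> X (\<lambda>x. x)"
    unfolding assms(3) by (rule symplectic_chart_identity)
  interpret X: symplectic_chart S \<omega> X "\<lambda>x. x"
    by (rule chart)
  have X: "vadd X = (+)" "vscale X = (*\<^sub>R)" "vform X = \<omega>" "vcarrier X = S"
    by (simp_all add: assms(3) subspace_with_form_def)
  have CS: "C \<subseteq> S"
    using assms(4) X(4) by (simp add: coisotropic_def vsubspace_def)
  have orth: "vorth X C = perp C"
    using X.vorth_image[OF CS] by simp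
  have C: "subspace C" "perp C \<subseteq> C"
    using assms(4) X.vsubspace_image[OF CS] orth by (simp_all add: coisotropic_def)
  obtain Y D' where "coisotropic_splitting S \<omega> Y (perp C) D'" and YC: "Y + perp C = C"
    by (rule coisotropic_splitting_exists[OF C(1) CS C(2)])
  then interpret coisotropic_splitting S \<omega> Y "perp C" D'
    by simp
  have orth': "vorth (subspace_with_form S \<omega>) C = perp C"
    using orth assms(3) by simp
  have V: "symplectic_chart Y \<omega> (reduced_space X C) coset"
    unfolding assms(3) by (rule symplectic_chart_reduced_space[OF YC[symmetric] orth'])
  have red: "indexed_reduction X C ((\<lambda>x. x) ` L) = (coset ` reduction (perp C) L, dim (L \<inter> perp C))"
    if L: "lagrangian L" for L
  proof -
    have "subspace (L \<inter> perp C)" "L \<inter> perp C \<subseteq> S"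
      using L D(2,3) by (auto simp: lagrangian_def subspace_inter)
    then have "vdim X (L \<inter> perp C) = dim (L \<inter> perp C)"
      using X.vdim_image[of "L \<inter> perp C"] by simp
    then show ?thesis
      using lag_reduction_eq[OF YC[symmetric] orth' L] orth assms(3)
      by (simp add: indexed_reduction_def excess_def)
  qed
  have r: "r = dim (perp C)"
    using assms(5) orth X.vdim_image[OF D(2,3)] by simp
  show ?thesis
    unfolding r by (rule quotient_map_reduction[OF chart V red])
qed


end
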